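(* $\lambda_5(n,m)=\Omega\big(n\alpha(n,m)2^{\alpha(n,m)}\big)$ and $\lambda_5(n)=\Omega\big(n\alpha(n)2^{\alpha(n)}\big)$.
   Context: A sequence contains an alternation of length $7$ if there are distinct symbols $a\ne b$ and indices $i_1<\dots<i_7$ whose entries are $a,b,a,b,a,b,a$. $\lambda_5(n)$ is the maximum length of a sequence using at most $n$ distinct symbols with no two consecutive equal entries and no alternation of length $7$. A block is a sequence of pairwise distinct symbols; $\lambda_5(n,m)$ is the maximum length of a sequence using at most $n$ distinct symbols, with no alternation of length 7, that is a concatenation of at most $m$ blocks. Ackermann's function: $a_{1,j}=2^j$, $a_{i,1}=2$ ($i\ge2$), $a_{i,j}=w\cdot a_{i-1,w}$ with $w=a_{i,j-1}$ ($i,j\ge2$); $\alpha(n,m)=\min\{i: a_{i,j}\ge m,\ j=\max\{\lceil n/m\rceil,3\}\}$, $\alpha(n)=\alpha(n,n)$. *)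

theory Defs
  imports Complex_Main "HOL-Library.Sublist"
begin

definition has_alt7 :: "nat list \<Rightarrow> bool" where
  "has_alt7 xs \<longleftrightarrow> (\<exists>a b. a \<noteq> b \<and> subseq [a, b, a, b, a, b, a] xs)"

definition no_adj_rep :: "nat list \<Rightarrow> bool" where
  "no_adj_rep xs \<longleftrightarrow> (\<forall>i. Suc i < length xs \<longrightarrow> xs ! i \<noteq> xs ! Suc i)"

definition is_m_block :: "nat \<Rightarrow> nat list \<Rightarrow> bool" where
  "is_m_block m xs \<longleftrightarrow> (\<exists>bs. length bs \<le> m \<and> xs = concat bs \<and> (\<forall>b\<in>set bs. distinct b))"

definition lambda5 :: "nat \<Rightarrow> nat" where
  "lambda5 n = Sup {length xs | xs. card (set xs) \<le> n \<and> no_adj_rep xs \<and> \<not> has_alt7 xs}"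

definition lambda5_blocks :: "nat \<Rightarrow> nat \<Rightarrow> nat" where
  "lambda5_blocks n m = Sup {length xs | xs. card (set xs) \<le> n \<and> is_m_block m xs \<and> \<not> has_alt7 xs}"

text \<open>Ackermann's function a_{i,j}, meaningful for i, j \<ge> 1 (other values are dummies).\<close>
fun ack :: "nat \<Rightarrow> nat \<Rightarrow> nat" where
  "ack 0 j = 0"
| "ack (Suc 0) j = 2 ^ j"
| "ack (Suc (Suc i)) 0 = 0"
| "ack (Suc (Suc i)) (Suc 0) = 2"
| "ack (Suc (Suc i)) (Suc (Suc j)) =
     ack (Suc (Suc i)) (Suc j) * ack (Suc i) (ack (Suc (Suc i)) (Suc j))"

definition alpha2 :: "nat \<Rightarrow> nat \<Rightarrow> nat" where
  "alpha2 n m = (LEAST i. i \<ge> 1 \<and> ack i (max (nat \<lceil>real n / real m\<rceil>) 3) \<ge> m)"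

definition alpha1 :: "nat \<Rightarrow> nat" where
  "alpha1 n = alpha2 n n"

end

theory Submission
  imports Defs "HOL-Library.Nat_Bijection"
begin

text \<open>
  The flag of a block tells whether the block consists of first occurrences of its symbols
  (\<^term>\<open>True\<close>) or of later occurrences (\<^term>\<open>False\<close>). From a sequence of level \<open>k\<close> one gets a
  sequence of level \<open>k + 1\<close> by doubling every block \<open>b\<close> of later occurrences into \<open>b\<close>, \<open>rev b\<close>, by
  replacing every block of first occurrences by a whole order-4 sequence over its symbols, and by
  shuffling each resulting block into its own fresh copy of a level \<open>k + 1\<close> sequence with smaller
  blocks. Two symbols \<open>x\<close>, \<open>y\<close> that share a block share no other one, and the sequence has the form
  \<open>y* x* [x y] x* y*\<close> on them, without the part \<open>y* x*\<close> if the block is one of first occurrences;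
  it is this missing part that leaves room for the alternations of the order-4 sequence, so that the
  total stays at six runs. The shuffle separates all symbols that shared a block and creates only
  new pairs of the required form. The number of later occurrences of a symbol satisfies
  \<open>v (k + 1) = 2 v k + 2 ^ k\<close>, so that \<open>v k = (k + 2) 2 ^ (k - 1)\<close>, and the iterated shuffling
  raises the number of blocks by one Ackermann level.
\<close>

section \<open>Words with a bounded number of runs\<close>

text \<open>\<open>fits [p, q, \<dots>] w\<close> says that \<open>w\<close> belongs to the regular language \<open>p* q* \<dots>\<close>.\<close>

inductive fits :: "'a list \<Rightarrow> 'a list \<Rightarrow> bool" where
  fits_Nil: "fits ps []"
| fits_stay: "fits (p # ps) w \<Longrightarrow> fits (p # ps) (p # w)"
| fits_skip: "fits ps w \<Longrightarrow> fits (p # ps) w"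

lemma fits_prepend: "fits ps w \<Longrightarrow> fits (qs @ ps) w"
  by (induction qs) (auto intro: fits_skip)

lemma fits_append: "fits ps w \<Longrightarrow> fits qs v \<Longrightarrow> fits (ps @ qs) (w @ v)"
  by (induction rule: fits.induct) (auto intro: fits_prepend fits.intros)

lemma fits_mono: "subseq ps qs \<Longrightarrow> fits ps w \<Longrightarrow> fits qs w"
proof (induction arbitrary: w rule: list_emb.induct)
  case (list_emb_Nil ys) 
  then show ?case by (cases rule: fits.cases) (auto intro: fits_Nil)
next
  case (list_emb_Cons xs ys y) then show ?case by (auto intro: fits_skip)
next
  case (list_emb_Cons2 x y xs ys)
  \<comment> \<open>Rule induction on \<open>fits\<close> needs a variable pattern, so the pattern
    is tied to \<open>r\<close> by an equation; the same device recurs below.\<close>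
  have "fits (x # ys) w" if "fits r w" "r = x # xs" for r w
    using that by (induction rule: fits.induct) (auto intro: fits.intros list_emb_Cons2.IH)
  then show ?case using list_emb_Cons2 by auto
qed

lemma fits_dup: "fits qs w \<Longrightarrow> qs = p # p # ps \<Longrightarrow> fits (p # ps) w"
  by (induction rule: fits.induct) (auto intro: fits.intros)

lemma fits_Cons_cong:
  assumes "\<And>w. fits ps w \<Longrightarrow> fits qs w" and "fits (p # ps) w" 
  shows "fits (p # qs) w"
proof -
  have "fits (p # qs) w" if "fits r w" "r = p # ps" for r w
    using that by (induction rule: fits.induct) (auto intro: fits.intros assms(1))
  then show ?thesis using assms(2) by auto
qed

text \<open>Since \<open>p* p* = p*\<close>, equal neighbours of a pattern merge. Run counts of
  composed sequences are obtained by concatenating patterns and merging at the seams.\<close>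

lemma fits_remdups_adj: "fits ps w \<Longrightarrow> fits (remdups_adj ps) w"
proof (induction ps arbitrary: w rule: remdups_adj.induct)
  case (3 x y xs)
  show ?case
  proof (cases "x = y")
    case True
    then show ?thesis using 3 fits_dup by fastforce
  next
    case False
    then show ?thesis using 3 fits_Cons_cong[of "y # xs" "remdups_adj (y # xs)" x w] by auto
  qed
qed auto

lemma fits_singleton: "set w \<subseteq> {p} \<Longrightarrow> fits [p] w"
  by (induction w) (auto intro: fits.intros)

lemma fits_self: "fits w w"
  by (induction w) (auto intro: fits.intros)

lemma fits_map: "fits ps w \<Longrightarrow> fits (map f ps) (map f w)"
  by (induction rule: fits.induct) (auto intro: fits.intros)

lemma fits_Cons_other: "fits (p # qs) (a # v) \<Longrightarrow> a \<noteq> p \<Longrightarrow> fits qs (a # v)"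
  by (erule fits.cases) auto

lemma fits_ConsD:
  assumes "fits ps (a # v)"
  shows "fits ps v"
proof -
  have "fits ps (tl w)" if "fits ps w" for w
    using that
  proof (induction rule: fits.induct)
    case (fits_stay p ps w)
    then show ?case by simp
  next
    case (fits_skip ps w p)
    then show ?case by (intro fits.fits_skip)
  qed (simp add: fits_Nil)
  then show ?thesis using assms by fastforce
qed

lemma fits_subseq: "subseq v w \<Longrightarrow> fits ps w \<Longrightarrow> fits ps v"
proof (induction arbitrary: ps rule: list_emb.induct)
  case (list_emb_Cons xs ys y)
  show ?case by (rule list_emb_Cons.IH[OF fits_ConsD[OF list_emb_Cons.prems]])
next
  case (list_emb_Cons2 x y xs ys)
  have "fits ps (x # xs)" if "fits ps w" "w = x # ys" for ps w
    using that by (induction rule: fits.induct) (auto intro: fits.intros list_emb_Cons2.IH)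
  then show ?case using list_emb_Cons2 by auto
qed (auto intro: fits_Nil)

text \<open>A letter replaced by a word over it only stretches or deletes a part of its run, and an
  empty piece stays empty.\<close>

lemma fits_expand:
  "list_all2 (\<lambda>b s. length b \<le> 1 \<and> set s \<subseteq> set b) bs ss \<Longrightarrow> fits ps (concat bs) \<Longrightarrow> fits ps (concat ss)"
proof (induction arbitrary: ps rule: list_all2_induct)
  case (Cons b bs s ss)
  consider "b = []" | a where "b = [a]" using Cons.hyps by (cases b) auto
  then show ?case
  proof cases
    case 2
    have *: "fits ps (s @ concat ss)" if "fits ps w" "w = a # concat bs" for ps w
      using that
    proof (induction rule: fits.induct)
      case (fits_stay p ps w)
      have "fits [p] s" using Cons.hyps 2 fits_stay by (intro fits_singleton) auto
      moreover have "fits (p # ps) (concat ss)" using Cons.IH fits_stay by auto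
      ultimately have "fits ([p] @ p # ps) (s @ concat ss)" by (rule fits_append)
      then show ?case by (intro fits_dup) auto
    qed (auto intro: fits_skip)
    then show ?thesis using Cons.prems 2 by auto
  qed (use Cons in auto)
qed auto

text \<open>Without adjacent repetitions no letter of the pattern can serve two letters of
  \<open>w\<close>.\<close>

lemma fits_length: "fits ps w \<Longrightarrow> distinct_adj w \<Longrightarrow> length w \<le> length ps"
proof (induction ps arbitrary: w)
  case Nil
  then show ?case by (cases rule: fits.cases) auto
next
  case (Cons p ps)
  show ?case
  proof (cases w)
    case (Cons a v)
    show ?thesis
    proof (cases "a = p")
      case True
      have "fits (p # ps) v" using fits_ConsD Cons.prems \<open>w = a # v\<close> by metis
      then have "fits ps v" using Cons.prems \<open>w = a # v\<close> True
        by (cases v) (auto intro: fits_Nil dest: fits_Cons_other)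
      then show ?thesis using Cons.IH[of v] Cons.prems \<open>w = a # v\<close> by (auto simp: distinct_adj_Cons)
    next
      case False
      then show ?thesis using Cons.IH Cons.prems \<open>w = a # v\<close> fits_Cons_other by fastforce
    qed
  qed auto
qed

text \<open>For distinct \<open>x\<close>, \<open>y\<close> a nonempty word over them fits this
  pattern iff it has at most \<open>n\<close> runs when it begins with \<open>x\<close>, and at most
  \<open>n - 1\<close> when it begins with \<open>y\<close>.\<close>

fun alternate :: "nat \<Rightarrow> 'a \<Rightarrow> 'a \<Rightarrow> 'a list" where
  "alternate 0 x y = []"
| "alternate (Suc n) x y = x # alternate n y x"

lemma length_alternate [simp]: "length (alternate n x y) = n"
  by (induction n arbitrary: x y) auto

lemma subseq_alternate: "m \<le> n \<Longrightarrow> subseq (alternate m x y) (alternate n x y)"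
proof (induction m arbitrary: n x y)
  case (Suc m) then show ?case by (cases n) auto
qed auto

lemma fits_alternate_mono: "fits (alternate m x y) w \<Longrightarrow> m \<le> n \<Longrightarrow> fits (alternate n x y) w"
  using fits_mono subseq_alternate by metis

lemma map_alternate: "map f (alternate n x y) = alternate n (f x) (f y)"
  by (induction n arbitrary: x y) auto

section \<open>Sequences of flagged blocks\<close>

type_synonym 'a blocks = "(bool \<times> 'a list) list"

definition word :: "'a blocks \<Rightarrow> 'a list" where
  "word Z = concat (map snd Z)"

definition occ :: "'a \<Rightarrow> 'a blocks \<Rightarrow> bool list" where
  "occ x Z = map fst (filter (\<lambda>B. x \<in> set (snd B)) Z)"

definition cnt :: "bool \<Rightarrow> 'a blocks \<Rightarrow> nat" where
  "cnt c Z = length (filter (\<lambda>B. fst B = c) Z)"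

definition proj :: "'a \<Rightarrow> 'a \<Rightarrow> 'a blocks \<Rightarrow> 'a list" where
  "proj x y Z = filter (\<lambda>z. z = x \<or> z = y) (word Z)"

definition apart :: "'a \<Rightarrow> 'a \<Rightarrow> 'a blocks \<Rightarrow> bool" where
  "apart x y Z \<longleftrightarrow> (\<forall>B\<in>set Z. \<not> (x \<in> set (snd B) \<and> y \<in> set (snd B)))"

text \<open>The pattern \<open>y* x* [x y] x* y*\<close>.\<close>

definition meet :: "'a \<Rightarrow> 'a \<Rightarrow> 'a blocks \<Rightarrow> bool" where
  "meet x y Z \<longleftrightarrow> (\<exists>P c b Q. Z = P @ (c, b) # Q \<and> filter (\<lambda>z. z = x \<or> z = y) b = [x, y] \<and>
     apart x y P \<and> apart x y Q \<and> fits [y, x] (proj x y P) \<and> fits [x, y] (proj x y Q))"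

text \<open>\<open>K\<close> limits only pairs that never share a block. A pair that shares one has
  the five runs \<open>y x y x y\<close> at most, whatever \<open>K\<close> is. The roles of
  \<open>x\<close> and \<open>y\<close> differ, hence the two orders in
  \<open>valid\<close>.\<close>

definition ok :: "nat \<Rightarrow> 'a \<Rightarrow> 'a \<Rightarrow> 'a blocks \<Rightarrow> bool" where
  "ok K x y Z \<longleftrightarrow> apart x y Z \<and> fits (alternate K x y) (proj x y Z) \<or> meet x y Z"

definition sized :: "nat \<Rightarrow> nat \<Rightarrow> 'a blocks \<Rightarrow> bool" where
  "sized f g Z \<longleftrightarrow> (\<forall>B\<in>set Z. distinct (snd B) \<and> length (snd B) = (if fst B then f else g))"

text \<open>\<open>occ x Z\<close> lists flags in the order of the blocks, so \<open>True\<close> in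
  front makes the flag mark the first occurrence of \<open>x\<close>.\<close>

definition regular :: "nat \<Rightarrow> 'a blocks \<Rightarrow> bool" where
  "regular v Z \<longleftrightarrow> (\<forall>x\<in>set (word Z). occ x Z = True # replicate v False)"

definition valid :: "nat \<Rightarrow> nat \<Rightarrow> nat \<Rightarrow> nat \<Rightarrow> 'a blocks \<Rightarrow> bool" where
  "valid K v f g Z \<longleftrightarrow> sized f g Z \<and> regular v Z \<and> (\<forall>x y. x \<noteq> y \<longrightarrow> ok K x y Z \<or> ok K y x Z)"

text \<open>This is all that is asked of pairs in a host sequence: blocks may be shared arbitrarily
  there, because shuffling separates the host symbols.\<close>

definition runs_le :: "nat \<Rightarrow> 'a blocks \<Rightarrow> bool" where
  "runs_le K S \<longleftrightarrow> (\<forall>x y. x \<noteq> y \<longrightarrow>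
     fits (alternate K x y) (proj x y S) \<or> fits (alternate K y x) (proj x y S))"

definition ren :: "('a \<Rightarrow> 'b) \<Rightarrow> 'a blocks \<Rightarrow> 'b blocks" where
  "ren f Z = map (\<lambda>B. (fst B, map f (snd B))) Z"

section \<open>Elementary calculus of flagged blocks\<close>

lemma word_simps [simp]: "word [] = []" "word (B # Z) = snd B @ word Z" "word (Y @ Z) = word Y @ word Z"
  by (auto simp: word_def)

lemma occ_simps [simp]: "occ x [] = []" "occ x (Y @ Z) = occ x Y @ occ x Z"
  "occ x (B # Z) = (if x \<in> set (snd B) then fst B # occ x Z else occ x Z)"
  by (auto simp: occ_def)

lemma cnt_simps [simp]: "cnt c [] = 0" "cnt c (Y @ Z) = cnt c Y + cnt c Z"
  "cnt c (B # Z) = (if fst B = c then Suc (cnt c Z) else cnt c Z)"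
  by (auto simp: cnt_def)

lemma proj_simps [simp]: "proj x y [] = []" "proj x y (Y @ Z) = proj x y Y @ proj x y Z"
  "proj x y (B # Z) = filter (\<lambda>z. z = x \<or> z = y) (snd B) @ proj x y Z"
  by (auto simp: proj_def)

lemma apart_simps [simp]: "apart x y []" "apart x y (Y @ Z) \<longleftrightarrow> apart x y Y \<and> apart x y Z"
  "apart x y (B # Z) \<longleftrightarrow> \<not> (x \<in> set (snd B) \<and> y \<in> set (snd B)) \<and> apart x y Z"
  by (auto simp: apart_def)

lemma ren_simps [simp]: "ren f [] = []" "ren f (Y @ Z) = ren f Y @ ren f Z"
  "ren f (B # Z) = (fst B, map f (snd B)) # ren f Z"
  by (auto simp: ren_def)

lemma length_ren [simp]: "length (ren f Z) = length Z"
  by (simp add: ren_def)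

lemma word_ren [simp]: "word (ren f Z) = map f (word Z)"
  by (induction Z) auto

lemma cnt_ren [simp]: "cnt c (ren f Z) = cnt c Z"
  by (induction Z) auto

lemma proj_sym: "proj x y Z = proj y x Z"
  unfolding proj_def by (rule filter_cong) auto

lemma apart_sym: "apart x y Z = apart y x Z"
  unfolding apart_def by auto

lemma set_proj: "set (proj x y Z) = set (word Z) \<inter> {x, y}"
  by (auto simp: proj_def)

lemma occ_eq_Nil_iff: "occ x Z = [] \<longleftrightarrow> x \<notin> set (word Z)"
  by (induction Z) auto

lemma apart_absent: "x \<notin> set (word Z) \<or> y \<notin> set (word Z) \<Longrightarrow> apart x y Z"
  by (induction Z) auto

lemma proj_absent: "x \<notin> set (word Z) \<Longrightarrow> y \<notin> set (word Z) \<Longrightarrow> proj x y Z = []"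
  by (auto simp: proj_def filter_empty_conv)

lemma fits_proj_singleton: "y \<notin> set (word Z) \<or> x = y \<Longrightarrow> fits [x] (proj x y Z)"
  "x \<notin> set (word Z) \<or> x = y \<Longrightarrow> fits [y] (proj x y Z)"
  by (intro fits_singleton; auto simp: set_proj)+

lemma ok_absent:
  assumes "x \<notin> set (word Z)" "K \<ge> 1"
  shows "ok K y x Z"
proof -
  have "fits (alternate 1 y x) (proj y x Z)"
    using fits_proj_singleton(1)[of x Z y] assms by simp
  then have "fits (alternate K y x) (proj y x Z)" using assms(2) by (rule fits_alternate_mono)
  moreover have "apart y x Z" using assms by (intro apart_absent) auto
  ultimately show ?thesis by (simp add: ok_def)
qed

lemma ok_surround:
  assumes "ok K x y Z" "x \<notin> set (word A)" "y \<notin> set (word A)" "x \<notin> set (word B)" "y \<notin> set (word B)"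
  shows "ok K x y (A @ Z @ B)"
proof -
  have p: "proj x y A = []" "proj x y B = []" "apart x y A" "apart x y B"
    using assms by (simp_all add: proj_absent apart_absent)
  show ?thesis
  proof (cases "meet x y Z")
    case True
    then obtain P c b Q where "Z = P @ (c, b) # Q" "filter (\<lambda>z. z = x \<or> z = y) b = [x, y]"
      "apart x y P" "apart x y Q" "fits [y, x] (proj x y P)" "fits [x, y] (proj x y Q)"
      unfolding meet_def by blast
    then have "meet x y (A @ Z @ B)" unfolding meet_def using p
      by (intro exI[of _ "A @ P"] exI[of _ c] exI[of _ b] exI[of _ "Q @ B"]) simp
    then show ?thesis by (simp add: ok_def)
  next
    case False
    then show ?thesis using assms(1) p by (simp add: ok_def)
  qed
qed

section \<open>Renaming of symbols and insertion of fresh ones\<close>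

lemma filter_map_inj:
  "inj_on f A \<Longrightarrow> insert x (insert y (set b)) \<subseteq> A \<Longrightarrow>
    filter (\<lambda>z. z = f x \<or> z = f y) (map f b) = map f (filter (\<lambda>z. z = x \<or> z = y) b)"
  by (induction b) (auto simp: inj_on_eq_iff)

lemma proj_ren:
  "inj_on f A \<Longrightarrow> insert x (insert y (set (word Z))) \<subseteq> A \<Longrightarrow> proj (f x) (f y) (ren f Z) = map f (proj x y Z)"
  unfolding proj_def using filter_map_inj by simp

lemma occ_ren:
  "inj_on f A \<Longrightarrow> insert x (set (word Z)) \<subseteq> A \<Longrightarrow> occ (f x) (ren f Z) = occ x Z"
proof (induction Z)
  case (Cons B Z)
  then have "f x \<in> f ` set (snd B) \<longleftrightarrow> x \<in> set (snd B)" by (auto simp: inj_on_image_mem_iff)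
  then show ?case using Cons by auto
qed auto

lemma apart_ren: "inj f \<Longrightarrow> apart (f x) (f y) (ren f Z) = apart x y Z"
  by (induction Z) (auto simp: inj_image_mem_iff)

lemma ok_ren:
  assumes "inj f" "ok K x y Z"
  shows "ok K (f x) (f y) (ren f Z)"
proof (cases "meet x y Z")
  case True
  then obtain P c b Q where "Z = P @ (c, b) # Q" "filter (\<lambda>z. z = x \<or> z = y) b = [x, y]"
    "apart x y P" "apart x y Q" "fits [y, x] (proj x y P)" "fits [x, y] (proj x y Q)"
    unfolding meet_def by blast
  then have "meet (f x) (f y) (ren f Z)" unfolding meet_def using assms
    by (intro exI[of _ "ren f P"] exI[of _ c] exI[of _ "map f b"] exI[of _ "ren f Q"])
      (auto simp: apart_ren proj_ren[of f UNIV] filter_map_inj[of f UNIV]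
        dest: fits_map[of _ _ f])
  then show ?thesis by (simp add: ok_def)
next
  case False
  then show ?thesis using assms
    by (auto simp: ok_def apart_ren proj_ren[of f UNIV] map_alternate dest: fits_map[of _ _ f])
qed

text \<open>The symbols of \<open>xs\<close> go, in order, one each to the ends of the blocks
  flagged \<open>c\<close>. At the end an inserted symbol follows the old ones, which is the order
  that \<open>meet\<close> wants. Symbols in excess are lost, hence the bounds
  \<open>length xs \<le> cnt c D\<close> below.\<close>

fun ins :: "bool \<Rightarrow> 'a list \<Rightarrow> 'a blocks \<Rightarrow> 'a blocks" where
  "ins c xs [] = []"
| "ins c [] D = D"
| "ins c (x # xs) ((d, b) # D) =
     (if d = c then (d, b @ [x]) # ins c xs D else (d, b) # ins c (x # xs) D)"

lemma ins_Nil [simp]: "ins c [] D = D"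
  by (cases D) auto

lemma length_ins [simp]: "length (ins c xs D) = length D"
  by (induction c xs D rule: ins.induct) auto

lemma ins_append: "ins c xs (A @ B) = ins c xs A @ ins c (drop (cnt c A) xs) B"
  by (induction c xs A rule: ins.induct) auto

lemma set_word_ins_subset: "set (word (ins c xs D)) \<subseteq> set xs \<union> set (word D)"
  by (induction c xs D rule: ins.induct) auto

lemma set_word_ins: "length xs \<le> cnt c D \<Longrightarrow> set (word (ins c xs D)) = set xs \<union> set (word D)"
  by (induction c xs D rule: ins.induct) auto

lemma proj_ins_old: "x \<notin> set xs \<Longrightarrow> y \<notin> set xs \<Longrightarrow> proj x y (ins c xs D) = proj x y D"
  by (induction c xs D rule: ins.induct) auto

lemma proj_ins_new:
  "length xs \<le> cnt c D \<Longrightarrow> x \<notin> set (word D) \<Longrightarrow> y \<notin> set (word D) \<Longrightarrow>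
    proj x y (ins c xs D) = filter (\<lambda>z. z = x \<or> z = y) xs"
proof (induction c xs D rule: ins.induct)
  case (3 c x xs d b D)
  then show ?case by (auto simp: filter_empty_conv)
qed (auto simp: proj_absent filter_empty_conv)

lemma apart_ins_old: "x \<notin> set xs \<Longrightarrow> y \<notin> set xs \<Longrightarrow> apart x y (ins c xs D) = apart x y D"
  by (induction c xs D rule: ins.induct) auto

lemma apart_ins_new:
  "x \<noteq> y \<Longrightarrow> x \<notin> set (word D) \<Longrightarrow> y \<notin> set (word D) \<Longrightarrow> apart x y (ins c xs D)"
  by (induction c xs D rule: ins.induct) (auto simp: apart_absent)

lemma occ_ins_old: "x \<notin> set xs \<Longrightarrow> occ x (ins c xs D) = occ x D"
  by (induction c xs D rule: ins.induct) auto

lemma occ_ins_new: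
  "length xs \<le> cnt c D \<Longrightarrow> distinct xs \<Longrightarrow> x \<notin> set (word D) \<Longrightarrow>
    occ x (ins c xs D) = (if x \<in> set xs then [c] else [])"
proof (induction c xs D rule: ins.induct)
  case (3 c y xs d b D)
  then show ?case by (auto simp: occ_ins_old occ_eq_Nil_iff set_word_ins)
qed (auto simp: occ_eq_Nil_iff)

text \<open>Isolates the one block that receives \<open>a\<close>. As \<open>xs\<close> is distinct
  and \<open>a\<close> is new, neither side of that block contains \<open>a\<close>.\<close>

lemma ins_split:
  "a \<in> set xs \<Longrightarrow> distinct xs \<Longrightarrow> length xs \<le> cnt c D \<Longrightarrow> a \<notin> set (word D) \<Longrightarrow>
    \<exists>P b Q P' Q'. D = P @ (c, b) # Q \<and> ins c xs D = P' @ (c, b @ [a]) # Q' \<and>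
      set (word P') \<subseteq> set (word P) \<union> (set xs - {a}) \<and> set (word Q') \<subseteq> set (word Q) \<union> (set xs - {a})"
proof (induction c xs D rule: ins.induct)
  case (3 c x xs d b D)
  consider "d = c" "x = a" | "d = c" "x \<noteq> a" | "d \<noteq> c" by blast
  then show ?case
  proof cases
    case 1
    have "ins c (x # xs) ((d, b) # D) = [] @ (c, b @ [a]) # ins c xs D" "(d, b) # D = [] @ (c, b) # D"
      using 1 by simp_all
    moreover have "set (word (ins c xs D)) \<subseteq> set (word D) \<union> (set (x # xs) - {a})"
      using 1 "3.prems"(2) set_word_ins_subset[of c xs D] by auto
    moreover have "set (word ([] :: 'a blocks)) \<subseteq> set (word ([] :: 'a blocks)) \<union> (set (x # xs) - {a})"
      by simp
    ultimately show ?thesis by blast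
  next
    case 2
    have "a \<in> set xs" "distinct xs" "length xs \<le> cnt c D" "a \<notin> set (word D)" using 2 "3.prems" by auto
    from "3.IH"(1)[OF 2(1) this] obtain P b' Q P' Q' where
      D: "D = P @ (c, b') # Q" and I: "ins c xs D = P' @ (c, b' @ [a]) # Q'" and
      W: "set (word P') \<subseteq> set (word P) \<union> (set xs - {a})" "set (word Q') \<subseteq> set (word Q) \<union> (set xs - {a})"
      by blast
    have "ins c (x # xs) ((d, b) # D) = ((d, b @ [x]) # P') @ (c, b' @ [a]) # Q'"
      "(d, b) # D = ((d, b) # P) @ (c, b') # Q" using 2 I by (simp_all add: D[symmetric])
    moreover have "set (word ((d, b @ [x]) # P')) \<subseteq> set (word ((d, b) # P)) \<union> (set (x # xs) - {a})"
      "set (word Q') \<subseteq> set (word Q) \<union> (set (x # xs) - {a})"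
      using W 2(2) by auto
    ultimately show ?thesis by blast
  next
    case 3
    have "length (x # xs) \<le> cnt c D" "a \<notin> set (word D)" using 3 "3.prems" by auto
    from "3.IH"(2)[OF 3 "3.prems"(1,2) this] obtain P b' Q P' Q' where
      D: "D = P @ (c, b') # Q" and I: "ins c (x # xs) D = P' @ (c, b' @ [a]) # Q'" and
      W: "set (word P') \<subseteq> set (word P) \<union> (set (x # xs) - {a})"
      "set (word Q') \<subseteq> set (word Q) \<union> (set (x # xs) - {a})"
      by blast
    have "ins c (x # xs) ((d, b) # D) = ((d, b) # P') @ (c, b' @ [a]) # Q'"
      "(d, b) # D = ((d, b) # P) @ (c, b') # Q" using 3 I by (simp_all add: D[symmetric])
    moreover have "set (word ((d, b) # P')) \<subseteq> set (word ((d, b) # P)) \<union> (set (x # xs) - {a})"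
      using W(1) by auto
    ultimately show ?thesis using W(2) by blast
  qed
qed auto

lemma ok_ins:
  assumes "ok K x y D" "x \<notin> set xs" "y \<notin> set xs"
  shows "ok K x y (ins c xs D)"
proof (cases "meet x y D")
  case True
  then obtain P d b Q where D: "D = P @ (d, b) # Q" "filter (\<lambda>z. z = x \<or> z = y) b = [x, y]"
    "apart x y P" "apart x y Q" "fits [y, x] (proj x y P)" "fits [x, y] (proj x y Q)"
    unfolding meet_def by blast
  define ys where "ys = drop (cnt c P) xs"
  have ys: "x \<notin> set ys" "y \<notin> set ys" using assms unfolding ys_def by (auto dest: in_set_dropD)
  \<comment> \<open>The shared block may itself receive a symbol; this is neither \<open>x\<close>
    nor \<open>y\<close>, so the projection of the block stays \<open>[x, y]\<close>.\<close>
  have "\<exists>b' ys'. ins c ys ((d, b) # Q) = (d, b') # ins c ys' Q \<and>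
      filter (\<lambda>z. z = x \<or> z = y) b' = [x, y] \<and> set ys' \<subseteq> set ys"
  proof (cases ys)
    case (Cons z zs)
    then show ?thesis using D(2) ys
      by (cases "d = c") (auto intro: exI[of _ "b @ [z]"] exI[of _ zs] exI[of _ "z # zs"])
  qed (use D(2) in auto)
  then obtain b' ys' where b': "ins c ys ((d, b) # Q) = (d, b') # ins c ys' Q"
      "filter (\<lambda>z. z = x \<or> z = y) b' = [x, y]" "set ys' \<subseteq> set ys"
    by blast
  have ys': "x \<notin> set ys'" "y \<notin> set ys'" using ys b' by auto
  have "meet x y (ins c xs D)" unfolding meet_def
    using D b' ys' assms
    by (intro exI[of _ "ins c xs P"] exI[of _ d] exI[of _ b'] exI[of _ "ins c ys' Q"])
      (auto simp: ins_append ys_def proj_ins_old apart_ins_old)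
  then show ?thesis by (simp add: ok_def)
next
  case False
  then show ?thesis using assms by (auto simp: ok_def proj_ins_old apart_ins_old)
qed

section \<open>Shuffling\<close>

text \<open>A block of the host sequence is absorbed by a copy of its own of the guest sequence, the copies
  being told apart by their position \<open>t\<close>.\<close>

definition host :: "nat \<Rightarrow> nat" where "host a = prod_encode (0, a)"
definition guest :: "nat \<Rightarrow> nat \<Rightarrow> nat" where "guest t b = prod_encode (Suc t, b)"

lemma host_guest_simps [simp]: "host a = host a' \<longleftrightarrow> a = a'" "guest t b = guest t' b' \<longleftrightarrow> t = t' \<and> b = b'"
  "host a \<noteq> guest t b" "guest t b \<noteq> host a"
  by (auto simp: host_def guest_def)

lemma inj_host: "inj host" and inj_guest: "inj (guest t)"
  by (auto intro!: injI)

lemma host_guest_cases [case_names host guest]: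
  obtains a where "x = host a" | t b where "x = guest t b"
proof -
  obtain p a where "x = prod_encode (p, a)" using prod_decode_inverse[of x] by (metis surj_pair)
  then show ?thesis using that by (cases p) (auto simp: host_def guest_def)
qed

text \<open>The guest depends on the flag because an insertion lengthens only the blocks of that
  flag: \<open>D True\<close> has its blocks of first occurrences one too short,
  \<open>D False\<close> its other blocks, and after the insertion all copies have the same
  sizes.\<close>

fun fill :: "(bool \<Rightarrow> nat blocks) \<Rightarrow> nat \<Rightarrow> nat blocks \<Rightarrow> nat blocks" where
  "fill D t [] = []"
| "fill D t ((c, xs) # S) = ins c (map host xs) (ren (guest t) (D c)) @ fill D (Suc t) S"

lemma blocks_induct [case_names Nil Cons]:
  "P [] \<Longrightarrow> (\<And>c xs S. P S \<Longrightarrow> P ((c, xs) # S)) \<Longrightarrow> P S"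
  by (induction S) auto

lemma fill_append: "fill D t (A @ B) = fill D t A @ fill D (t + length A) B"
  by (induction A arbitrary: t rule: blocks_induct) auto

text \<open>Five runs are the worst case for a host symbol \<open>a\<close> and a guest symbol
  \<open>z\<close>, namely \<open>a* z* a z* a*\<close>; this is the source of
  \<open>K \<ge> 5\<close>.\<close>

locale filling =
  fixes D :: "bool \<Rightarrow> nat blocks" and K :: nat
  assumes K: "K \<ge> 5"
    and D_distinct: "\<And>c B. B \<in> set (D c) \<Longrightarrow> distinct (snd B)"
    and D_ok: "\<And>c x y. x \<noteq> y \<Longrightarrow> ok K x y (D c) \<or> ok K y x (D c)"
begin

definition fits_into :: "nat blocks \<Rightarrow> bool" where
  "fits_into S \<longleftrightarrow> (\<forall>B\<in>set S. distinct (snd B) \<and> length (snd B) \<le> cnt (fst B) (D (fst B)))"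

lemma fits_into_simps [simp]: "fits_into []" 
  "fits_into (B # S) \<longleftrightarrow> distinct (snd B) \<and> length (snd B) \<le> cnt (fst B) (D (fst B)) \<and> fits_into S"
  "fits_into (A @ S) \<longleftrightarrow> fits_into A \<and> fits_into S"
  by (auto simp: fits_into_def)

lemma guest_notin_fill:
  "fits_into S \<Longrightarrow> s < t \<or> t + length S \<le> s \<Longrightarrow> guest s b \<notin> set (word (fill D t S))"
proof (induction S arbitrary: t rule: blocks_induct)
  case (Cons c xs S)
  then show ?case by (auto simp: set_word_ins)
qed auto

lemma host_in_fill: "fits_into S \<Longrightarrow> host a \<in> set (word (fill D t S)) \<longleftrightarrow> a \<in> set (word S)"
proof (induction S arbitrary: t rule: blocks_induct)
  case (Cons c xs S)
  then show ?case by (auto simp: set_word_ins)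
qed auto

text \<open>Host blocks are served in their order and \<open>ins\<close> keeps the order inside
  each, so the host symbols still spell \<open>S\<close>.\<close>

lemma proj_host_host: "fits_into S \<Longrightarrow> proj (host a) (host a') (fill D t S) = map host (proj a a' S)"
proof (induction S arbitrary: t rule: blocks_induct)
  case (Cons c xs S)
  have "proj (host a) (host a') (ins c (map host xs) (ren (guest t) (D c))) =
      filter (\<lambda>z. z = host a \<or> z = host a') (map host xs)"
    using Cons by (intro proj_ins_new) auto
  then show ?case using Cons by (simp add: filter_map_inj[of host UNIV] inj_host)
qed auto

text \<open>Each block of a copy receives at most one host symbol.\<close>

lemma apart_host_host: "a \<noteq> a' \<Longrightarrow> apart (host a) (host a') (fill D t S)"
  by (induction S arbitrary: t rule: blocks_induct) (simp_all add: apart_ins_new image_iff)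

lemma fill_split:
  assumes "fits_into S" "t \<le> s" "s < t + length S"
  obtains A c xs B where "S = A @ (c, xs) # B" "length A = s - t"
    "fill D t S = fill D t A @ ins c (map host xs) (ren (guest s) (D c)) @ fill D (Suc s) B"
    "fits_into A" "fits_into B" "distinct xs" "length xs \<le> cnt c (D c)"
proof -
  define A B where "A = take (s - t) S" and "B = drop (Suc (s - t)) S"
  obtain c xs where cx: "S ! (s - t) = (c, xs)" by (cases "S ! (s - t)")
  have S: "S = A @ (c, xs) # B" unfolding A_def B_def cx[symmetric]
    using assms by (intro id_take_nth_drop) auto
  have l: "length A = s - t" using assms by (auto simp: A_def)
  have "t + length A = s" using l assms by simp
  then have "fill D t S = fill D t A @ ins c (map host xs) (ren (guest s) (D c)) @ fill D (Suc s) B"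
    unfolding S fill_append by simp
  then show ?thesis using that[OF S l] assms(1) unfolding S by simp
qed

lemma ok_guest_guest_same:
  assumes S: "fits_into S" and xy: "x \<noteq> y"
  shows "ok K (guest s x) (guest s y) (fill D t S) \<or> ok K (guest s y) (guest s x) (fill D t S)"
proof (cases "t \<le> s \<and> s < t + length S")
  case True
  then obtain A c xs B where d: "S = A @ (c, xs) # B" "length A = s - t"
    "fill D t S = fill D t A @ ins c (map host xs) (ren (guest s) (D c)) @ fill D (Suc s) B"
    "fits_into A" "fits_into B" "distinct xs" "length xs \<le> cnt c (D c)"
    using fill_split[OF S] by metis
  have n: "guest s z \<notin> set (word (fill D t A))" "guest s z \<notin> set (word (fill D (Suc s) B))"
    "guest s z \<notin> set (map host xs)" for z
    using d guest_notin_fill True by auto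
  have "ok K (guest s x) (guest s y) (fill D t S)" if "ok K x y (D c)" for x y
    unfolding d(3) using ok_ren[OF inj_guest that, of s] n by (intro ok_surround ok_ins)
  then show ?thesis using D_ok[OF xy] by blast
next
  case False
  then have "guest s x \<notin> set (word (fill D t S))" using guest_notin_fill[OF S] by auto
  then show ?thesis by (intro disjI2 ok_absent) (use K in auto)
qed

text \<open>All of copy \<open>s\<close> precedes copy \<open>s'\<close>, which leaves two
  runs.\<close>

lemma ok_guest_guest_diff:
  assumes S: "fits_into S" and st: "s < s'"
  shows "ok K (guest s x) (guest s' y) (fill D t S)"
proof (cases "t \<le> s' \<and> s' < t + length S")
  case True
  then obtain A c xs B where d: "S = A @ (c, xs) # B" "length A = s' - t"
    "fill D t S = fill D t A @ ins c (map host xs) (ren (guest s') (D c)) @ fill D (Suc s') B"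
    "fits_into A" "fits_into B" "distinct xs" "length xs \<le> cnt c (D c)"
    using fill_split[OF S] by metis
  define M where "M = ins c (map host xs) (ren (guest s') (D c)) @ fill D (Suc s') B"
  have M: "fill D t S = fill D t A @ M" by (simp add: d(3) M_def)
  have 1: "guest s' y \<notin> set (word (fill D t A))" using guest_notin_fill[OF d(4)] d True by auto
  have 2: "guest s x \<notin> set (word M)"
    using guest_notin_fill[OF d(5), of s "Suc s'"] st set_word_ins[of "map host xs" c "ren (guest s') (D c)"] d
    by (auto simp: M_def)
  have "fits [guest s x, guest s' y] (proj (guest s x) (guest s' y) (fill D t S))"
    using fits_append[of "[guest s x]" "proj (guest s x) (guest s' y) (fill D t A)" "[guest s' y]"
        "proj (guest s x) (guest s' y) M"] 1 2
    by (simp add: M fits_proj_singleton)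
  then have "fits (alternate 2 (guest s x) (guest s' y)) (proj (guest s x) (guest s' y) (fill D t S))"
    by (simp add: numeral_2_eq_2)
  then have "fits (alternate K (guest s x) (guest s' y)) (proj (guest s x) (guest s' y) (fill D t S))"
    by (rule fits_alternate_mono) (use K in auto)
  moreover have "apart (guest s x) (guest s' y) (fill D t S)"
    unfolding M using 1 2 by (simp add: apart_absent)
  ultimately show ?thesis by (simp add: ok_def)
next
  case False
  then have "guest s' y \<notin> set (word (fill D t S))" using guest_notin_fill[OF S] by auto
  then show ?thesis using K ok_absent[of _ _ K] by auto
qed

text \<open>Outside copy \<open>s\<close> there is only \<open>a\<close>; inside it \<open>a\<close>
  occurs at most once. Without \<open>a\<close> in the copy the form is \<open>a* z* a*\<close>. If
  \<open>a\<close> joins a block without \<open>z\<close> it is \<open>a* z* a z* a*\<close>. If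
  \<open>a\<close> joins a block of \<open>z\<close> it is \<open>a* z* [z a] z* a*\<close>, a
  \<open>meet\<close> with \<open>z\<close> in the first role.\<close>

lemma ok_host_guest:
  assumes S: "fits_into S"
  shows "ok K (host a) (guest s z) (fill D t S) \<or> ok K (guest s z) (host a) (fill D t S)"
proof (cases "t \<le> s \<and> s < t + length S")
  case True
  then obtain A c xs B where d: "S = A @ (c, xs) # B" "length A = s - t"
    "fill D t S = fill D t A @ ins c (map host xs) (ren (guest s) (D c)) @ fill D (Suc s) B"
    "fits_into A" "fits_into B" "distinct xs" "length xs \<le> cnt c (D c)"
    using fill_split[OF S] by metis
  let ?M = "ins c (map host xs) (ren (guest s) (D c))"
  let ?a = "host a" and ?z = "guest s z"
  have nA: "?z \<notin> set (word (fill D t A))" and nB: "?z \<notin> set (word (fill D (Suc s) B))"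
    using d guest_notin_fill True by auto
  have aA: "fits [?a] (proj ?a ?z (fill D t A))" "fits [?a] (proj ?a ?z (fill D (Suc s) B))"
    "apart ?a ?z (fill D t A)" "apart ?a ?z (fill D (Suc s) B)"
    using nA nB by (simp_all add: fits_proj_singleton apart_absent)
  show ?thesis
  proof (cases "a \<in> set xs")
    case False
    have n: "?a \<notin> set (word ?M)"
      using set_word_ins_subset[of c "map host xs" "ren (guest s) (D c)"] False by auto
    then have "fits [?z] (proj ?a ?z ?M)" "apart ?a ?z ?M"
      by (simp_all add: fits_proj_singleton apart_absent)
    then have "fits ([?a] @ [?z] @ [?a]) (proj ?a ?z (fill D t S))" "apart ?a ?z (fill D t S)"
      using aA by (simp_all only: d(3) proj_simps apart_simps fits_append)
    then have "fits (alternate 3 ?a ?z) (proj ?a ?z (fill D t S))" "apart ?a ?z (fill D t S)"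
      by (simp_all add: numeral_3_eq_3)
    then show ?thesis using fits_alternate_mono[of 3 ?a ?z _ K] K by (simp add: ok_def)
  next
    case True
    have "?a \<in> set (map host xs)" "distinct (map host xs)" "length (map host xs) \<le> cnt c (ren (guest s) (D c))"
      "?a \<notin> set (word (ren (guest s) (D c)))"
      using True d by (auto simp: distinct_map inj_on_def)
    from ins_split[OF this] obtain P b Q P' Q' where
      D: "ren (guest s) (D c) = P @ (c, b) # Q" and M: "?M = P' @ (c, b @ [?a]) # Q'" and
      W: "set (word P') \<subseteq> set (word P) \<union> (set (map host xs) - {?a})"
        "set (word Q') \<subseteq> set (word Q) \<union> (set (map host xs) - {?a})"
      by blast
    have "set (word (ren (guest s) (D c))) \<subseteq> range (guest s)" by auto
    then have "set (word P) \<subseteq> range (guest s)" "set (word Q) \<subseteq> range (guest s)" "set b \<subseteq> range (guest s)"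
      unfolding D by auto
    then have n: "?a \<notin> set (word P')" "?a \<notin> set (word Q')" "?a \<notin> set b" using W by auto
    have f: "fits [?z] (proj ?a ?z P')" "fits [?z] (proj ?a ?z Q')" "apart ?a ?z P'" "apart ?a ?z Q'"
      using n by (simp_all add: fits_proj_singleton apart_absent)
    have Z: "fill D t S = (fill D t A @ P') @ (c, b @ [?a]) # (Q' @ fill D (Suc s) B)"
      by (simp add: d(3) M)
    have db: "distinct b"
    proof -
      have "(c, b) \<in> set (ren (guest s) (D c))" by (simp add: D)
      then obtain b' where "(c, b') \<in> set (D c)" "b = map (guest s) b'" by (auto simp: ren_def)
      then show ?thesis using D_distinct by (auto simp: distinct_map inj_on_def)
    qed
    show ?thesis
    proof (cases "?z \<in> set b")
      case True
      have "filter (\<lambda>u. u = ?z \<or> u = ?a) b = filter (\<lambda>u. u = ?z) b"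
        using n(3) by (intro filter_cong) auto
      also have "\<dots> = [?z]" using db True by (induction b) (auto simp: filter_empty_conv)
      finally have "filter (\<lambda>u. u = ?z \<or> u = ?a) (b @ [?a]) = [?z, ?a]" by simp
      moreover have "fits ([?a] @ [?z]) (proj ?a ?z (fill D t A @ P'))"
        "fits ([?z] @ [?a]) (proj ?a ?z (Q' @ fill D (Suc s) B))"
        using aA f by (simp_all only: proj_simps fits_append)
      ultimately have "meet ?z ?a (fill D t S)" unfolding meet_def Z
        using aA f
        by (intro exI[of _ "fill D t A @ P'"] exI[of _ c] exI[of _ "b @ [?a]"] exI[of _ "Q' @ fill D (Suc s) B"])
          (simp add: proj_sym[of ?z] apart_sym[of ?z])
      then show ?thesis by (simp add: ok_def)
    next
      case False
      have "filter (\<lambda>u. u = ?a \<or> u = ?z) b = []" using n(3) False by (auto simp: filter_empty_conv)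
      then have "proj ?a ?z (fill D t S) = proj ?a ?z (fill D t A) @ proj ?a ?z P' @ [?a] @
          proj ?a ?z Q' @ proj ?a ?z (fill D (Suc s) B)"
        by (simp add: Z)
      moreover have "fits ([?a] @ [?z] @ [?a] @ [?z] @ [?a]) \<dots>"
        using aA f by (intro fits_append fits_self)
      ultimately have "fits (alternate 5 ?a ?z) (proj ?a ?z (fill D t S))"
        by (simp add: eval_nat_numeral)
      moreover have "apart ?a ?z (fill D t S)" using aA f False by (simp add: Z)
      ultimately show ?thesis using fits_alternate_mono[of 5 ?a ?z _ K] K by (simp add: ok_def)
    qed
  qed
next
  case False
  then have "guest s z \<notin> set (word (fill D t S))" using guest_notin_fill[OF S] by auto
  then show ?thesis using K ok_absent[of _ _ K] by auto
qed

lemma ok_fill: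
  assumes "fits_into S" "runs_le K S" "x \<noteq> y"
  shows "ok K x y (fill D t S) \<or> ok K y x (fill D t S)"
proof (cases x rule: host_guest_cases)
  case (host a)
  show ?thesis
  proof (cases y rule: host_guest_cases)
    case y: (host a')
    have ok: "ok K (host u) (host w) (fill D t S)" if "u \<noteq> w" "fits (alternate K u w) (proj u w S)" for u w
      using apart_host_host that fits_map[OF that(2), of host]
      by (simp add: ok_def proj_host_host assms map_alternate)
    have "a \<noteq> a'" using assms host y by auto
    then show ?thesis using assms(2) ok[of a a'] ok[of a' a]
      unfolding host y runs_le_def proj_sym[of a' a] by blast
  next
    case (guest s b)
    then show ?thesis using ok_host_guest assms host by blast
  qed
next
  case (guest s b)
  show ?thesis
  proof (cases y rule: host_guest_cases)
    case (host a')
    then show ?thesis using ok_host_guest assms guest by blast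
  next
    case y: (guest s' b')
    show ?thesis
    proof (cases "s = s'")
      case True
      then show ?thesis using ok_guest_guest_same assms guest y by auto
    next
      case False
      then show ?thesis using ok_guest_guest_diff assms guest y by (cases "s < s'") auto
    qed
  qed
qed

lemma occ_host:
  "fits_into S \<Longrightarrow> occ (host a) (fill D t S) = occ a S"
proof (induction S arbitrary: t rule: blocks_induct)
  case (Cons c xs S)
  have "occ (host a) (ins c (map host xs) (ren (guest t) (D c))) = (if host a \<in> set (map host xs) then [c] else [])"
    using Cons by (intro occ_ins_new) (auto simp: distinct_map inj_on_def)
  then show ?case using Cons by auto
qed auto

lemma occ_guest:
  assumes S: "fits_into S" "guest s b \<in> set (word (fill D t S))"
  shows "\<exists>c. b \<in> set (word (D c)) \<and> occ (guest s b) (fill D t S) = occ b (D c)"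
proof -
  have "t \<le> s \<and> s < t + length S" using guest_notin_fill[OF S(1), of s t b] S(2) by (meson not_less)
  then obtain A c xs B where d: "S = A @ (c, xs) # B" "length A = s - t"
    "fill D t S = fill D t A @ ins c (map host xs) (ren (guest s) (D c)) @ fill D (Suc s) B"
    "fits_into A" "fits_into B" "distinct xs" "length xs \<le> cnt c (D c)" "t \<le> s"
    using fill_split[OF S(1)] by metis
  have n: "guest s b \<notin> set (word (fill D t A))" "guest s b \<notin> set (word (fill D (Suc s) B))"
    using d guest_notin_fill by auto
  then have "occ (guest s b) (fill D t A) = []" "occ (guest s b) (fill D (Suc s) B) = []"
    by (simp_all add: occ_eq_Nil_iff)
  moreover have "guest s b \<notin> set (map host xs)" by auto
  ultimately have "occ (guest s b) (fill D t S) = occ b (D c)"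
    unfolding d(3) by (simp add: occ_ins_old occ_ren[OF inj_guest])
  moreover have "guest s b \<in> set (word (ins c (map host xs) (ren (guest s) (D c))))" using S(2) n unfolding d(3) by auto
  then have "b \<in> set (word (D c))"
    using set_word_ins_subset[of c "map host xs" "ren (guest s) (D c)"] by auto
  ultimately show ?thesis by blast
qed

lemma regular_fill:
  assumes "fits_into S" "regular v S" "\<And>c. regular v (D c)"
  shows "regular v (fill D t S)"
  unfolding regular_def
proof
  fix x assume x: "x \<in> set (word (fill D t S))"
  show "occ x (fill D t S) = True # replicate v False"
  proof (cases x rule: host_guest_cases)
    case (host a)
    then show ?thesis using x assms occ_host host_in_fill by (auto simp: regular_def)
  next
    case (guest s b)
    then show ?thesis using occ_guest assms x unfolding regular_def by metis
  qed
qed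

lemma length_fill: "(\<And>c. length (D c) \<le> w) \<Longrightarrow> length (fill D t S) \<le> w * length S"
proof (induction S arbitrary: t rule: blocks_induct)
  case (Cons c xs S)
  then show ?case using add_mono[of "length (D c)" w "length (fill D (Suc t) S)"] by simp
qed auto

end

section \<open>Block sizes after shuffling, and the induction on block sizes\<close>

lemma cnt_pos: "(c, b) \<in> set D \<Longrightarrow> cnt c D > 0"
  by (induction D) auto

lemma in_set_ins_sized:
  "length xs = cnt c D \<Longrightarrow> (d, b) \<in> set (ins c xs D) \<Longrightarrow>
     \<exists>b'. (d, b') \<in> set D \<and> length b = length b' + (if d = c then 1 else 0)"
proof (induction c xs D rule: ins.induct)
  case (2 c B D)
  \<comment> \<open>When the symbols run out, equality of the lengths leaves no block flagged
    \<open>c\<close>, so nothing that should grow is missed.\<close>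
  then show ?case using cnt_pos[of d b "B # D"] by (auto split: if_splits)
qed (auto split: if_splits)

lemma distinct_ins:
  "(d, b) \<in> set (ins c xs D) \<Longrightarrow> distinct xs \<Longrightarrow> set xs \<inter> set (word D) = {} \<Longrightarrow>
    \<forall>B\<in>set D. distinct (snd B) \<Longrightarrow> distinct b"
  by (induction c xs D rule: ins.induct) (auto split: if_splits)

lemma sized_append [simp]: "sized f g (A @ B) \<longleftrightarrow> sized f g A \<and> sized f g B"
  by (auto simp: sized_def)

lemma sized_ren: "inj_on h (set (word D)) \<Longrightarrow> sized f g D \<Longrightarrow> sized f g (ren h D)"
  by (induction D) (auto simp: sized_def distinct_map inj_on_Un)

lemma sized_ins:
  assumes "sized f g D" "distinct xs" "length xs = cnt c D" "set xs \<inter> set (word D) = {}"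
  shows "sized (if c then Suc f else f) (if c then g else Suc g) (ins c xs D)"
  unfolding sized_def
proof
  fix B assume B: "B \<in> set (ins c xs D)"
  obtain d b where db: "B = (d, b)" by (cases B)
  have "distinct b" using distinct_ins[of d b c xs D] B assms unfolding db sized_def by blast
  moreover obtain b' where "(d, b') \<in> set D" "length b = length b' + (if d = c then 1 else 0)"
    using in_set_ins_sized[of xs c D d b] B assms unfolding db by blast
  ultimately show "distinct (snd B) \<and>
      length (snd B) = (if fst B then if c then Suc f else f else if c then g else Suc g)"
    using assms(1) unfolding db sized_def by fastforce
qed

lemma sized_fill:
  assumes "\<forall>B\<in>set S. distinct (snd B) \<and> length (snd B) = cnt (fst B) (D (fst B))"
    "sized f (Suc g) (D True)" "sized (Suc f) g (D False)"
  shows "sized (Suc f) (Suc g) (fill D t S)"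
  using assms(1)
proof (induction S arbitrary: t rule: blocks_induct)
  case Nil
  then show ?case by (simp add: sized_def)
next
  case (Cons c xs S)
  have i: "inj_on (guest t) X" for X by (auto intro: inj_onI)
  have x: "distinct (map host xs)" "set (map host xs) \<inter> set (word (ren (guest t) (D c))) = {}"
    "length (map host xs) = cnt c (ren (guest t) (D c))"
    using Cons by (auto simp: distinct_map inj_on_def)
  have "sized (Suc f) (Suc g) (ins c (map host xs) (ren (guest t) (D c)))"
    using sized_ins[OF sized_ren[OF i assms(2)], of "map host xs" True]
      sized_ins[OF sized_ren[OF i assms(3)], of "map host xs" False] x
    by (cases c) auto
  then show ?case using Cons by simp
qed

lemma valid_fill:
  assumes "K \<ge> 5" and S: "sized p q S" "regular v S" "runs_le K S"
    and T: "valid K v f (Suc g) (D True)" "cnt True (D True) = p"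
    and F: "valid K v (Suc f) g (D False)" "cnt False (D False) = q"
  shows "valid K v (Suc f) (Suc g) (fill D t S)"
proof -
  interpret filling D K
  proof
    show "distinct (snd B)" if "B \<in> set (D c)" for c B
      using T(1) F(1) that unfolding valid_def sized_def by (cases c) auto
    show "ok K x y (D c) \<or> ok K y x (D c)" if "x \<noteq> y" for c x y
      using T(1) F(1) that unfolding valid_def by (cases c) auto
  qed fact
  have sz: "\<forall>B\<in>set S. distinct (snd B) \<and> length (snd B) = cnt (fst B) (D (fst B))"
    using S(1) T(2) F(2) by (auto simp: sized_def)
  then have "fits_into S" by (auto simp: fits_into_def)
  moreover have "regular v (D c)" for c using T(1) F(1) by (cases c) (auto simp: valid_def)
  ultimately show ?thesis
    using sized_fill[OF sz, of f g t] T(1) F(1) regular_fill[of S v t] ok_fill[of S _ _ t] S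
    by (simp add: valid_def)
qed

lemma runs_le_empty_word: "K \<ge> 1 \<Longrightarrow> word Z = [] \<Longrightarrow> runs_le K Z"
  by (auto simp: runs_le_def proj_def intro: fits_Nil)

text \<open>Base of the induction on sizes: one empty block realizes size 0 for its own flag and any
  size for the other flag, of which there is no block.\<close>

lemma valid_single_empty: "valid K v (if c then 0 else n) (if c then n else 0) [(c, [])]"
  by (auto simp: valid_def sized_def regular_def ok_def intro: fits_Nil)

lemma cnt_pos_occ: "c \<in> set (occ x Z) \<Longrightarrow> cnt c Z \<ge> 1"
  by (induction Z) (auto split: if_splits)

lemma cnt_le_length: "cnt c Z \<le> length Z"
  by (simp add: cnt_def)

lemma regular_cnt_pos:
  assumes "regular v Z" "v \<ge> 1" "word Z \<noteq> []"
  shows "cnt c Z \<ge> 1"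
proof -
  obtain x where "x \<in> set (word Z)" using assms(3) by (meson last_in_set)
  then have "occ x Z = True # replicate v False" using assms by (auto simp: regular_def)
  then have "c \<in> set (occ x Z)" using assms(2) by (cases c) auto
  then show ?thesis by (rule cnt_pos_occ)
qed

text \<open>Induction on \<open>f + g\<close>. The guests come from sizes \<open>(f - 1, g)\<close>
  and \<open>(f, g - 1)\<close>, and the host has as block sizes the numbers of blocks that receive
  its symbols. With at most \<open>C h\<close> blocks in a guest and \<open>R (C h)\<close> in the
  host the result has at most \<open>C h * R (C h)\<close>, the shape of Ackermann's
  recursion.\<close>

lemma fill_family:
  assumes "K \<ge> 5" "v \<ge> 1" and "\<And>h. C h \<ge> 1" and R: "mono R" "\<And>h. C h * R (C h) \<le> C (Suc h)"
    and sub: "\<And>p q. p \<ge> 1 \<Longrightarrow> q \<ge> 1 \<Longrightarrow> \<exists>S :: nat blocks. sized p q S \<and> regular v S \<and> runs_le K S \<and>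
      word S \<noteq> [] \<and> length S \<le> R (max p q)"
    and "f \<ge> 1 \<or> g \<ge> 1"
  shows "\<exists>Z :: nat blocks. valid K v f g Z \<and> (g \<ge> 1 \<longrightarrow> cnt True Z \<ge> 1) \<and> (f \<ge> 1 \<longrightarrow> cnt False Z \<ge> 1) \<and>
    (f \<ge> 1 \<and> g \<ge> 1 \<longrightarrow> word Z \<noteq> []) \<and> length Z \<le> C (f + g)"
  using assms(7)
proof (induction "f + g" arbitrary: f g)
  case (Suc h)
  consider "f = 0" | "g = 0" | f' g' where "f = Suc f'" "g = Suc g'" by (meson not0_implies_Suc)
  then show ?case
  proof cases
    case 1
    then show ?thesis using valid_single_empty[of K v True g] assms(3)[of g]
      by (intro exI[of _ "[(True, [])]"]) auto
  next
    case 2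
    then show ?thesis using valid_single_empty[of K v False f] assms(3)[of f]
      by (intro exI[of _ "[(False, [])]"]) auto
  next
    case 3
    have "h = f' + g" "f' \<ge> 1 \<or> g \<ge> 1" "h = f + g'" "f \<ge> 1 \<or> g' \<ge> 1" using Suc 3 by auto
    \<comment> \<open>\<open>g \<ge> 1\<close> gives \<open>A\<close> a block of first occurrences
      and \<open>f \<ge> 1\<close> gives \<open>B\<close> one of later occurrences, so both block
      sizes of the host are positive, even when a guest is a single empty block.\<close>
    then obtain A B :: "nat blocks" where A: "valid K v f' g A" "cnt True A \<ge> 1" "length A \<le> C h"
      and B: "valid K v f g' B" "cnt False B \<ge> 1" "length B \<le> C h"
      using Suc.hyps(1)[of f' g] Suc.hyps(1)[of f g'] 3 by auto
    define p q where "p = cnt True A" and "q = cnt False B"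
    obtain S :: "nat blocks" where S: "sized p q S" "regular v S" "runs_le K S" "word S \<noteq> []" 
      "length S \<le> R (max p q)"
      using sub[of p q] A B unfolding p_def q_def by blast
    define D where "D c = (if c then A else B)" for c
    define Z where "Z = fill D 0 S"
    have v: "valid K v f g Z" unfolding Z_def 3
      by (rule valid_fill[of K p q]) (use assms A B S 3 in \<open>auto simp: D_def p_def q_def\<close>)
    have "max p q \<le> C h" using A B cnt_le_length[of True A] cnt_le_length[of False B] by (auto simp: p_def q_def)
    then have "length S \<le> R (C h)" using S R(1) by (meson monoD order_trans)
    interpret filling D K
    proof
      show "distinct (snd B')" if "B' \<in> set (D c)" for c B'
        using A(1) B(1) that unfolding valid_def sized_def by (cases c) (auto simp: D_def)
      show "ok K x y (D c) \<or> ok K y x (D c)" if "x \<noteq> y" for c x y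
        using A(1) B(1) that unfolding valid_def by (cases c) (auto simp: D_def)
    qed fact
    have "length Z \<le> C h * length S" unfolding Z_def using A B by (intro length_fill) (auto simp: D_def)
    also have "\<dots> \<le> C h * R (C h)" using \<open>length S \<le> R (C h)\<close> by simp
    also have "\<dots> \<le> C (f + g)" using R(2)[of h] Suc.hyps(2) by simp
    finally have "length Z \<le> C (f + g)" .
    moreover have "fits_into S" using S(1) by (auto simp: fits_into_def sized_def D_def p_def q_def)
    then have "word Z \<noteq> []"
      using S(4) host_in_fill[of S "hd (word S)" 0] unfolding Z_def by force
    moreover have "cnt c Z \<ge> 1" for c
      using v \<open>word Z \<noteq> []\<close> assms(2) regular_cnt_pos unfolding valid_def by blast
    ultimately show ?thesis using v by blast
  qed
qed auto

section \<open>Composition\<close>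

text \<open>The reversal makes the second copy of a block open with the symbol that closed the
  first: on a pair it reads \<open>[x, y] [y, x]\<close>, three runs instead of four.\<close>

fun expand :: "('a list \<Rightarrow> 'a blocks) \<Rightarrow> bool \<times> 'a list \<Rightarrow> 'a blocks" where
  "expand mid (c, b) = (if c then mid b else [(False, b), (False, rev b)])"

definition compose :: "('a list \<Rightarrow> 'a blocks) \<Rightarrow> 'a blocks \<Rightarrow> 'a blocks" where
  "compose mid Y = concat (map (expand mid) Y)"

lemma compose_simps [simp]: "compose mid [] = []" "compose mid (B # Y) = expand mid B @ compose mid Y"
  "compose mid (X @ Y) = compose mid X @ compose mid Y"
  by (auto simp: compose_def)

lemma proj_blocks: "proj x y Z = concat (map (\<lambda>B. filter (\<lambda>z. z = x \<or> z = y) (snd B)) Z)"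
  by (induction Z) auto

lemma proj_concat: "proj x y (concat Zs) = concat (map (proj x y) Zs)"
  by (induction Zs) auto

lemma occ_filter_fst: "occ x (filter fst Z) = filter id (occ x Z)"
  by (induction Z) auto

lemma set_word_filter_fst: "regular v Z \<Longrightarrow> set (word (filter fst Z)) = set (word Z)"
proof (intro set_eqI)
  fix x assume r: "regular v Z"
  show "x \<in> set (word (filter fst Z)) \<longleftrightarrow> x \<in> set (word Z)"
  proof (cases "x \<in> set (word Z)")
    case True
    then have "occ x Z = True # replicate v False" using r by (simp add: regular_def)
    then have "occ x (filter fst Z) \<noteq> []" by (simp add: occ_filter_fst)
    then show ?thesis using True by (simp add: occ_eq_Nil_iff)
  next
    case False
    then have "occ x (filter fst Z) = []" using occ_eq_Nil_iff[of x Z] by (simp add: occ_filter_fst)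
    then show ?thesis using False by (simp add: occ_eq_Nil_iff)
  qed
qed

text \<open>A pair that shares a block has form \<open>y* x* [x y] x* y*\<close>, whose merged
  pattern is \<open>alternate 5 y x\<close>.\<close>

lemma ok_runs:
  assumes "ok K x y Z" "K \<ge> 5" "x \<noteq> y"
  shows "fits (alternate K x y) (proj x y Z) \<or> fits (alternate K y x) (proj x y Z)"
proof (cases "meet x y Z")
  case True
  then obtain P c b Q where Z: "Z = P @ (c, b) # Q" "filter (\<lambda>z. z = x \<or> z = y) b = [x, y]"
    "fits [y, x] (proj x y P)" "fits [x, y] (proj x y Q)"
    unfolding meet_def by blast
  have "fits ([y, x] @ [x, y] @ [x, y]) (proj x y P @ [x, y] @ proj x y Q)"
    using Z by (intro fits_append fits_self)
  then have "fits (remdups_adj ([y, x] @ [x, y] @ [x, y])) (proj x y Z)"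
    using Z(1,2) by (intro fits_remdups_adj) simp
  then have "fits (alternate 5 y x) (proj x y Z)" using assms(3) by (simp add: eval_nat_numeral)
  then show ?thesis using fits_alternate_mono[of 5 y x "proj x y Z" K] assms(2) by simp
next
  case False
  then show ?thesis using assms(1) by (simp add: ok_def)
qed

lemma valid_runs_le: "valid K v f g Z \<Longrightarrow> K \<ge> 5 \<Longrightarrow> runs_le K Z"
  unfolding valid_def runs_le_def using ok_runs proj_sym by metis

text \<open>The assumption on \<open>remdups_adj\<close> says that \<open>r\<close> is odd:
  \<open>alternate r x y\<close> then ends in \<open>x\<close>, and the part \<open>x* y*\<close>
  that follows the block costs only one more run. \<open>u\<close> and \<open>w\<close> are the
  numbers of later occurrences in \<open>mid b\<close> and in \<open>Y\<close>.\<close>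

locale composition =
  fixes mid :: "'a list \<Rightarrow> 'a blocks" and Y :: "'a blocks" and K N p q r u w t :: nat
  assumes K: "K \<ge> 5" and Y: "valid K w N q Y"
    and mid_sized: "\<And>b. distinct b \<Longrightarrow> length b = N \<Longrightarrow> sized p q (mid b)"
    and mid_regular: "\<And>b. distinct b \<Longrightarrow> length b = N \<Longrightarrow> regular u (mid b)"
    and mid_word: "\<And>b. distinct b \<Longrightarrow> length b = N \<Longrightarrow> word (filter fst (mid b)) = b"
    and mid_fits: "\<And>b x y. distinct b \<Longrightarrow> length b = N \<Longrightarrow> x \<noteq> y \<Longrightarrow>
      filter (\<lambda>z. z = x \<or> z = y) b = [x, y] \<Longrightarrow> fits (alternate r x y) (proj x y (mid b))"
    and mid_length: "\<And>b. distinct b \<Longrightarrow> length b = N \<Longrightarrow> length (mid b) \<le> t"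
    and r: "\<And>(x :: 'a) y. x \<noteq> y \<Longrightarrow> remdups_adj (alternate r x y @ [x, y]) = alternate (Suc r) x y" "Suc r \<le> K"
begin

lemma blockD: "(c, b) \<in> set Y \<Longrightarrow> distinct b \<and> length b = (if c then N else q)"
  using Y unfolding valid_def sized_def by fastforce

lemma set_word_mid: "(True, b) \<in> set Y \<Longrightarrow> set (word (mid b)) = set b"
  using blockD[of True b] set_word_filter_fst[OF mid_regular, of b] mid_word[of b] by simp

lemma set_word_expand: "B \<in> set Y \<Longrightarrow> set (word (expand mid B)) = set (snd B)"
  using set_word_mid by (cases B) auto

lemma set_word_compose: "set X \<subseteq> set Y \<Longrightarrow> set (word (compose mid X)) = set (word X)"
proof (induction X)
  case (Cons B X)
  then show ?case using set_word_expand[of B] by simp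
qed simp

lemma sized_compose: "sized p q (compose mid Y)"
proof -
  have "sized p q (expand mid (c, b))" if "(c, b) \<in> set Y" for c b
    using blockD[OF that] mid_sized[of b] by (auto simp: sized_def)
  then have "set X \<subseteq> set Y \<Longrightarrow> sized p q (compose mid X)" for X
  proof (induction X rule: blocks_induct)
    case Nil
    then show ?case by (simp add: sized_def)
  qed (simp del: expand.simps)
  then show ?thesis by blast
qed

lemma occ_expand:
  assumes "(c, b) \<in> set Y" "x \<in> set b"
  shows "occ x (expand mid (c, b)) = (if c then True # replicate u False else [False, False])"
  using assms blockD[of c b] set_word_mid[of b] mid_regular[of b] by (auto simp: regular_def)

lemma occ_compose:
  "set X \<subseteq> set Y \<Longrightarrow> occ x (compose mid X) =
     concat (map (\<lambda>c. if c then True # replicate u False else [False, False]) (occ x X))"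
proof (induction X rule: blocks_induct)
  case (Cons c b X)
  show ?case
  proof (cases "x \<in> set b")
    case True
    then show ?thesis using Cons occ_expand[of c b x] by simp
  next
    case False
    then have "occ x (expand mid (c, b)) = []"
      using Cons(2) set_word_expand[of "(c, b)"] occ_eq_Nil_iff[of x "expand mid (c, b)"] by simp
    then show ?thesis using Cons False by simp
  qed
qed simp

text \<open>The first occurrence becomes a first one and \<open>u\<close> later ones; each of the
  \<open>w\<close> later ones becomes two.\<close>

lemma regular_compose: "regular (u + 2 * w) (compose mid Y)"
  unfolding regular_def
proof
  fix x assume "x \<in> set (word (compose mid Y))"
  then have "occ x Y = True # replicate w False"
    using Y set_word_compose[of Y] by (auto simp: valid_def regular_def)
  moreover have "concat (map (\<lambda>c. if c then True # replicate u False else [False, False]) (replicate w False))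
      = replicate (2 * w) False"
    by (induction w) auto
  ultimately show "occ x (compose mid Y) = True # replicate (u + 2 * w) False"
    by (simp add: occ_compose replicate_add)
qed

text \<open>Each block shows at most one of the two symbols, and its expansion shows no other, so
  \<open>fits_expand\<close> applies.\<close>

lemma fits_compose_apart:
  assumes "set X \<subseteq> set Y" "apart x y X" "fits ps (proj x y X)"
  shows "fits ps (proj x y (compose mid X))"
proof -
  have "list_all2 (\<lambda>b s. length b \<le> 1 \<and> set s \<subseteq> set b)
      (map (\<lambda>B. filter (\<lambda>z. z = x \<or> z = y) (snd B)) X) (map (proj x y) (map (expand mid) X))"
    unfolding list_all2_map1 list_all2_map2 list_all2_same
  proof
    fix B assume B: "B \<in> set X"
    then have "distinct (snd B)" using assms(1) blockD[of "fst B" "snd B"] by auto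
    then have d: "distinct (filter (\<lambda>z. z = x \<or> z = y) (snd B))" by simp
    have "\<not> (x \<in> set (snd B) \<and> y \<in> set (snd B))" using assms(2) B by (auto simp: apart_def)
    then have "card (set (filter (\<lambda>z. z = x \<or> z = y) (snd B))) \<le> 1"
      by (auto simp: card_le_Suc0_iff_eq)
    then have "length (filter (\<lambda>z. z = x \<or> z = y) (snd B)) \<le> 1" using distinct_card[OF d] by simp
    moreover have "set (proj x y (expand mid B)) \<subseteq> set (filter (\<lambda>z. z = x \<or> z = y) (snd B))"
      using set_word_expand[of B] B assms(1) by (auto simp: set_proj)
    ultimately show "length (filter (\<lambda>z. z = x \<or> z = y) (snd B)) \<le> 1 \<and>
        set (proj x y (expand mid B)) \<subseteq> set (filter (\<lambda>z. z = x \<or> z = y) (snd B))" by blast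
  qed
  then show ?thesis unfolding compose_def proj_concat
    by (rule fits_expand) (use assms(3) in \<open>simp add: proj_blocks\<close>)
qed

text \<open>A shared block of first occurrences has neither symbol before it, so \<open>r\<close>
  runs and \<open>x* y*\<close> merge into \<open>Suc r\<close>. Any other shared block yields
  \<open>y* x* [x y] [y x] x* y*\<close>, which merges into five runs again.\<close>

lemma fits_compose_meet:
  assumes "meet x y Y" "x \<noteq> y"
  shows "fits (alternate K x y) (proj x y (compose mid Y)) \<or> fits (alternate K y x) (proj x y (compose mid Y))"
proof -
  obtain P c b Q where Z: "Y = P @ (c, b) # Q" "filter (\<lambda>z. z = x \<or> z = y) b = [x, y]"
    "apart x y P" "apart x y Q" "fits [y, x] (proj x y P)" "fits [x, y] (proj x y Q)"
    using assms unfolding meet_def by blast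
  have b: "x \<in> set b" "y \<in> set b" using Z(2) by (metis (no_types, lifting) filter_is_subset list.set_intros subsetD)+
  have P: "set P \<subseteq> set Y" and Q: "set Q \<subseteq> set Y" and cb: "(c, b) \<in> set Y" by (auto simp: Z(1))
  have fP: "fits [y, x] (proj x y (compose mid P))" and fQ: "fits [x, y] (proj x y (compose mid Q))"
    using fits_compose_apart Z P Q by blast+
  have split: "proj x y (compose mid Y) =
      proj x y (compose mid P) @ proj x y (expand mid (c, b)) @ proj x y (compose mid Q)"
    by (simp add: Z(1))
  show ?thesis
  proof (cases c)
    case True
    \<comment> \<open>An earlier occurrence would put a flag in front of this \<open>True\<close>,
      while regularity allows \<open>True\<close> only at the head of
      \<open>occ z Y\<close>.\<close>
    have "z \<notin> set (word P)" if "z \<in> set b" for z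
    proof
      assume z: "z \<in> set (word P)"
      then obtain d ds where "occ z P = d # ds" using occ_eq_Nil_iff by (metis list.exhaust)
      moreover have "occ z Y = True # replicate w False"
        using Y z by (auto simp: valid_def regular_def Z(1))
      ultimately have "ds @ True # occ z Q = replicate w False"
        using that True by (simp add: Z(1))
      then have "True \<in> set (replicate w False)" by (metis in_set_conv_decomp)
      then show False by simp
    qed
    then have "proj x y (compose mid P) = []"
      using b set_word_compose[OF P] by (intro proj_absent) auto
    moreover have "fits (alternate r x y) (proj x y (mid b))"
      using mid_fits[of b x y] blockD[OF cb] True Z(2) assms(2) by simp
    ultimately have "fits (alternate r x y @ [x, y]) (proj x y (compose mid Y))"
      using fQ True by (auto simp: split intro: fits_append)
    then have "fits (alternate (Suc r) x y) (proj x y (compose mid Y))"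
      using fits_remdups_adj r(1)[OF assms(2)] by fastforce
    then show ?thesis using r(2) fits_alternate_mono[of "Suc r" x y "proj x y (compose mid Y)" K] by simp
  next
    case False
    have "proj x y (expand mid (c, b)) = [x, y] @ [y, x]"
      using False Z(2) by (simp flip: rev_filter)
    moreover have "fits ([y, x] @ ([x, y] @ [y, x]) @ [x, y])
        (proj x y (compose mid P) @ ([x, y] @ [y, x]) @ proj x y (compose mid Q))"
      using fP fQ by (intro fits_append fits_self)
    ultimately have "fits ([y, x] @ ([x, y] @ [y, x]) @ [x, y]) (proj x y (compose mid Y))"
      unfolding split by simp
    then have "fits (remdups_adj ([y, x] @ ([x, y] @ [y, x]) @ [x, y])) (proj x y (compose mid Y))"
      by (rule fits_remdups_adj)
    then have "fits (alternate 5 y x) (proj x y (compose mid Y))"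
      using assms(2) by (simp add: eval_nat_numeral)
    then show ?thesis using K fits_alternate_mono[of 5 y x "proj x y (compose mid Y)" K] by simp
  qed
qed

lemma runs_le_compose: "runs_le K (compose mid Y)"
  unfolding runs_le_def
proof (intro allI impI)
  have *: "fits (alternate K x y) (proj x y (compose mid Y)) \<or> fits (alternate K y x) (proj x y (compose mid Y))"
    if "ok K x y Y" "x \<noteq> y" for x y
    using that fits_compose_meet fits_compose_apart unfolding ok_def by blast
  fix x y :: 'a assume "x \<noteq> y"
  then have "ok K x y Y \<or> ok K y x Y" using Y by (simp add: valid_def)
  then show "fits (alternate K x y) (proj x y (compose mid Y)) \<or> fits (alternate K y x) (proj x y (compose mid Y))"
    using *[of x y] *[of y x] \<open>x \<noteq> y\<close> unfolding proj_sym[of y x] by blast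
qed

lemma length_compose: "length (compose mid Y) \<le> max 2 t * length Y"
proof -
  have "length (expand mid (c, b)) \<le> max 2 t" if "(c, b) \<in> set Y" for c b
    using blockD[OF that] mid_length[of b] by auto
  then have e: "length (expand mid B) \<le> max 2 t" if "B \<in> set Y" for B
    using that by (cases B) blast
  have "length (compose mid X) \<le> max 2 t * length X" if "set X \<subseteq> set Y" for X
    using that
  proof (induction X)
    case (Cons B X)
    then have "length (expand mid B) + length (compose mid X) \<le> max 2 t + max 2 t * length X"
      using e[of B] by (intro add_mono) auto
    then show ?case by simp
  qed simp
  then show ?thesis by blast
qed

end

text \<open>Relabels a block sequence along the order in which its symbols first occur, so that it
  starts with the symbols of a given list.\<close>

definition relabel :: "'a blocks \<Rightarrow> 'a list \<Rightarrow> 'a blocks" where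
  "relabel M b = ren (\<lambda>z. the (map_of (zip (word (filter fst M)) b) z)) M"

section \<open>Order-4 sequences renamed along their first occurrences\<close>

lemma distinct_word:
  "(\<forall>B\<in>set Z. distinct (snd B)) \<Longrightarrow> (\<And>x. length (occ x Z) \<le> 1) \<Longrightarrow> distinct (word Z)"
proof (induction Z)
  case (Cons B Z)
  have "length (occ x Z) \<le> 1" for x using Cons.prems(2)[of x] by (auto split: if_splits)
  moreover have "set (snd B) \<inter> set (word Z) = {}"
  proof (rule equals0I)
    fix x assume "x \<in> set (snd B) \<inter> set (word Z)"
    then have "length (occ x (B # Z)) = Suc (length (occ x Z))" "occ x Z \<noteq> []" by (simp_all add: occ_eq_Nil_iff)
    then show False using Cons.prems(2)[of x] by (cases "occ x Z") auto
  qed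
  ultimately show ?case using Cons by auto
qed simp

lemma distinct_firsts:
  assumes "sized f g M" "regular v M"
  shows "distinct (word (filter fst M))"
proof (rule distinct_word)
  show "\<forall>B\<in>set (filter fst M). distinct (snd B)" using assms(1) by (auto simp: sized_def)
  show "length (occ x (filter fst M)) \<le> 1" for x
    using assms(2) occ_eq_Nil_iff[of x M] by (cases "x \<in> set (word M)") (auto simp: occ_filter_fst regular_def)
qed

lemma length_firsts: "sized f g M \<Longrightarrow> length (word (filter fst M)) = f * cnt True M"
  by (induction M) (auto simp: sized_def)

text \<open>The earliest block with one of the two symbols is a block of first occurrences, so the
  projections of \<open>M\<close> and of its list of first occurrences begin alike.\<close>

lemma proj_starts_with_first:
  assumes "occ x M = [] \<or> hd (occ x M)" "occ y M = [] \<or> hd (occ y M)"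
    and "filter (\<lambda>z. z = x \<or> z = y) (word (filter fst M)) = [x, y]"
  shows "\<exists>w. proj x y M = x # w"
  using assms
proof (induction M rule: blocks_induct)
  case (Cons c b M)
  show ?case
  proof (cases "x \<in> set b \<or> y \<in> set b")
    case True
    then have c using Cons.prems(1,2) by auto
    moreover have "filter (\<lambda>z. z = x \<or> z = y) b \<noteq> []" using True by (auto simp: filter_empty_conv)
    then obtain a as where "filter (\<lambda>z. z = x \<or> z = y) b = a # as" by (metis list.exhaust)
    ultimately show ?thesis using Cons.prems(3) by auto
  next
    case False
    then have b: "filter (\<lambda>z. z = x \<or> z = y) b = []" by (auto simp: filter_empty_conv)
    have "\<exists>w. proj x y M = x # w"
      using Cons.prems b False by (intro Cons.IH) (auto split: if_splits)
    then show ?thesis using b by simp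
  qed
qed simp

lemma word_filter_ren: "word (filter fst (ren h M)) = map h (word (filter fst M))"
  by (induction M) auto

lemma regular_ren: "inj_on h (set (word M)) \<Longrightarrow> regular v M \<Longrightarrow> regular v (ren h M)"
  using occ_ren[of h "set (word M)"] by (auto simp: regular_def)

text \<open>\<open>e\<close> lists each symbol of \<open>M\<close> once, in order of first
  occurrence, so sending \<open>e\<close> to \<open>b\<close> renames injectively. If
  \<open>x\<close> precedes \<open>y\<close> in \<open>b\<close>, the projection begins with
  \<open>x\<close>, and the pattern of five runs can be taken to begin with \<open>x\<close> as
  well.\<close>

lemma relabel:
  assumes M: "valid 5 v f g M" and b: "distinct b" "length b = f * cnt True M"
  shows "sized f g (relabel M b)" "regular v (relabel M b)" "word (filter fst (relabel M b)) = b"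
    "x \<noteq> y \<Longrightarrow> filter (\<lambda>z. z = x \<or> z = y) b = [x, y] \<Longrightarrow> fits (alternate 5 x y) (proj x y (relabel M b))"
proof -
  define e where "e = word (filter fst M)"
  define h where "h z = the (map_of (zip e b) z)" for z
  have R: "relabel M b = ren h M" by (simp add: relabel_def h_def[abs_def] e_def)
  have szd: "sized f g M" and rg: "regular v M" using M by (auto simp: valid_def)
  have e: "distinct e" "length e = length b" "set e = set (word M)"
    using distinct_firsts[OF szd rg] length_firsts[OF szd] b set_word_filter_fst[OF rg] by (auto simp: e_def)
  have hb: "map h e = b"
    using e by (intro nth_equalityI) (auto simp: h_def map_of_zip_nth)
  then have inj: "inj_on h (set (word M))" using b(1) e(3) by (metis distinct_map)
  show "sized f g (relabel M b)" "regular v (relabel M b)" 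
    using sized_ren[OF inj szd] regular_ren[OF inj rg] by (auto simp: R)
  show "word (filter fst (relabel M b)) = b" using hb by (simp add: R word_filter_ren e_def)
  assume xy: "x \<noteq> y" "filter (\<lambda>z. z = x \<or> z = y) b = [x, y]"
  have "x \<in> set b" "y \<in> set b" using xy(2) by (metis (no_types, lifting) filter_is_subset list.set_intros subsetD)+
  then obtain x' y' where x': "x' \<in> set e" "x = h x'" and y': "y' \<in> set e" "y = h y'"
    using hb by (metis imageE set_map)
  have "map h (filter (\<lambda>z. z = x' \<or> z = y') e) = map h [x', y']"
    using filter_map_inj[OF inj, of x' y' e] x' y' e xy(2) hb by simp
  moreover have "inj_on h (set (filter (\<lambda>z. z = x' \<or> z = y') e) \<union> set [x', y'])"
    by (rule inj_on_subset[OF inj]) (use x' y' e in auto)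
  ultimately have f: "filter (\<lambda>z. z = x' \<or> z = y') e = [x', y']" using map_inj_on by blast
  have "occ z M = [] \<or> hd (occ z M)" for z
    using rg occ_eq_Nil_iff[of z M] by (cases "z \<in> set (word M)") (auto simp: regular_def)
  then obtain w where w: "proj x' y' M = x' # w"
    using proj_starts_with_first f unfolding e_def by metis
  have ne: "x' \<noteq> y'" using x' y' xy by auto
  have "fits (alternate 5 x' y') (proj x' y' M) \<or> fits (alternate 5 y' x') (proj x' y' M)"
    using valid_runs_le[OF M] ne by (simp add: runs_le_def)
  then have "fits (alternate 5 x' y') (proj x' y' M)"
  proof
    \<comment> \<open>The leading \<open>y'\<close> of the pattern is idle because the word begins
      with \<open>x'\<close>; the other four letters already begin with \<open>x'\<close>.\<close>
    assume "fits (alternate 5 y' x') (proj x' y' M)"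
    then have "fits (y' # alternate 4 x' y') (x' # w)" by (simp add: w eval_nat_numeral)
    then have "fits (alternate 4 x' y') (proj x' y' M)" using ne fits_Cons_other w by fastforce
    then show ?thesis by (rule fits_alternate_mono) simp
  qed
  then have "fits (map h (alternate 5 x' y')) (map h (proj x' y' M))" by (rule fits_map)
  moreover have "proj x y (relabel M b) = map h (proj x' y' M)"
    unfolding R x'(2) y'(2) by (rule proj_ren[OF inj]) (use x' y' e in auto)
  ultimately show "fits (alternate 5 x y) (proj x y (relabel M b))"
    by (simp add: map_alternate x' y')
qed

section \<open>Host sequences for the shuffling: doubled, nested and grid\<close>

definition admissible :: "nat \<Rightarrow> nat \<Rightarrow> nat \<Rightarrow> nat \<Rightarrow> nat blocks \<Rightarrow> bool" where
  "admissible K v p q S \<longleftrightarrow> sized p q S \<and> regular v S \<and> runs_le K S \<and> word S \<noteq> []"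

lemma length_relabel: "length (relabel M b) = length M"
  by (simp add: relabel_def)

lemma remdups_adj_alternate:
  assumes "x \<noteq> y"
  shows "remdups_adj (alternate 3 x y @ [x, y]) = alternate (Suc 3) x y"
    "remdups_adj (alternate 5 x y @ [x, y]) = alternate (Suc 5) x y"
  using assms by (simp_all add: eval_nat_numeral)

text \<open>The order-4 step: blocks of first occurrences are kept and only the others are doubled,
  so later occurrences double.\<close>

lemma admissible_double:
  fixes Y :: "nat blocks"
  assumes Y: "valid 5 w p q Y" and "word Y \<noteq> []"
  shows "\<exists>S. admissible 5 (2 * w) p q S \<and> length S \<le> 2 * length Y"
proof -
  \<comment> \<open>A pair has two runs in a kept block; \<open>r = 3\<close> is the next odd bound,
    and \<open>Suc r\<close> stays below 5.\<close>
  interpret composition "\<lambda>b. [(True, b)]" Y 5 p p q 3 0 w 1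
  proof
    fix b :: "nat list" and x y :: nat
    assume "filter (\<lambda>z. z = x \<or> z = y) b = [x, y]"
    moreover have "subseq [x, y] (alternate 3 x y)" by (simp add: eval_nat_numeral)
    ultimately show "fits (alternate 3 x y) (proj x y [(True, b)])"
      using fits_mono[OF _ fits_self[of "[x, y]"]] by simp
  qed (simp_all add: Y sized_def regular_def remdups_adj_alternate)
  show ?thesis using sized_compose regular_compose runs_le_compose length_compose set_word_compose[of Y] assms(2)
    unfolding admissible_def by (intro exI[of _ "compose (\<lambda>b. [(True, b)]) Y"]) auto
qed

text \<open>The order-5 step: \<open>p * cnt True M\<close> is the number of symbols of
  \<open>M\<close>, so a copy of \<open>M\<close> takes up exactly one block of first occurrences of
  \<open>Y\<close>. The five runs of \<open>M\<close> become six.\<close>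

lemma admissible_nest:
  fixes M Y :: "nat blocks"
  assumes M: "valid 5 u p q M" and Y: "valid 6 w (p * cnt True M) q Y" and "word Y \<noteq> []"
  shows "\<exists>S. admissible 6 (u + 2 * w) p q S \<and> length S \<le> max 2 (length M) * length Y"
proof -
  interpret composition "relabel M" Y 6 "p * cnt True M" p q 5 u w "length M"
    by standard (simp_all add: Y relabel[OF M] length_relabel remdups_adj_alternate)
  show ?thesis using sized_compose regular_compose runs_le_compose length_compose set_word_compose[of Y] assms(3)
    unfolding admissible_def by (intro exI[of _ "compose (relabel M) Y"]) auto
qed

lemma occ_uniform:
  "distinct (concat bs) \<Longrightarrow> occ x (map (Pair c) bs) = (if x \<in> set (concat bs) then [c] else [])"
  by (induction bs) (auto simp: occ_eq_Nil_iff word_def)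

lemma fits_upt: "x < y \<Longrightarrow> fits [x, y] (filter (\<lambda>z. z = x \<or> z = y) [0..<n])"
proof -
  assume "x < y"
  have "[0..<n] = [0..<min y n] @ [min y n..<n]" using upt_add_eq_append[of 0 "min y n" "n - min y n"] by simp
  moreover have "fits [x] (filter (\<lambda>z. z = x \<or> z = y) [0..<min y n])"
    by (rule fits_singleton) auto
  moreover have "fits [y] (filter (\<lambda>z. z = x \<or> z = y) [min y n..<n])"
    using \<open>x < y\<close> by (intro fits_singleton) auto
  ultimately show ?thesis using fits_append[of "[x]" _ "[y]"] by fastforce
qed

lemma concat_upt: "concat (map (\<lambda>i. [i * p..<Suc i * p]) [0..<q]) = [0..<p * q]"
proof (induction q)
  case (Suc q)
  then show ?case using upt_add_eq_append[of 0 "p * q" p] by (simp add: algebra_simps)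
qed simp

text \<open>The increasing list of \<open>p * q\<close> symbols is written twice, first cut into
  \<open>q\<close> blocks of size \<open>p\<close>, then into \<open>p\<close> blocks of size
  \<open>q\<close>. Two symbols \<open>x < y\<close> read \<open>x y x y\<close>.\<close>

lemma admissible_grid:
  assumes "p \<ge> 1" "q \<ge> 1" "K \<ge> 5"
  shows "\<exists>S. admissible K 1 p q S \<and> length S = p + q"
proof -
  define rows cols where "rows = map (\<lambda>i. [i * p..<Suc i * p]) [0..<q]" and "cols = map (\<lambda>i. [i * q..<Suc i * q]) [0..<p]"
  define S where "S = map (Pair True) rows @ map (Pair False) cols"
  have c: "concat rows = [0..<p * q]" "concat cols = [0..<p * q]"
    unfolding rows_def cols_def concat_upt by (simp_all add: mult.commute)
  have w: "word S = [0..<p * q] @ [0..<p * q]" by (simp add: S_def word_def comp_def c)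
  have "occ x S = [True, False]" if "x < p * q" for x
    using that by (simp add: S_def occ_uniform c)
  then have "regular 1 S" by (auto simp: regular_def w)
  moreover have "sized p q S" by (auto simp: sized_def S_def rows_def cols_def)
  moreover have "runs_le K S"
    unfolding runs_le_def
  proof (intro allI impI)
    have *: "fits (alternate K x y) (proj x y S)" if "x < y" for x y
    proof -
      have "fits ([x, y] @ [x, y]) (proj x y S)"
        unfolding proj_def w filter_append using that by (intro fits_append fits_upt)
      then have "fits (alternate 4 x y) (proj x y S)" by (simp add: eval_nat_numeral)
      then show ?thesis by (rule fits_alternate_mono) (use assms in simp)
    qed
    show "fits (alternate K x y) (proj x y S) \<or> fits (alternate K y x) (proj x y S)" if "x \<noteq> y" for x y
      using *[of x y] *[of y x] that unfolding proj_sym[of y x] by (cases "x < y") auto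
  qed
  moreover have "length S = p + q" by (simp add: S_def rows_def cols_def)
  ultimately show ?thesis using assms by (intro exI[of _ S]) (simp add: admissible_def w)
qed

section \<open>Block counts\<close>

lemma ack_rec: "i \<ge> 1 \<Longrightarrow> j \<ge> 1 \<Longrightarrow> ack (Suc i) (Suc j) = ack (Suc i) j * ack i (ack (Suc i) j)"
  by (cases i; cases j) auto

lemma power_le_ack: "i \<ge> 1 \<Longrightarrow> j \<ge> 1 \<Longrightarrow> 2 ^ j \<le> ack i j"
proof (induction i j rule: ack.induct)
  case (5 i j)
  define w where "w = ack (Suc (Suc i)) (Suc j)"
  have w: "2 ^ Suc j \<le> w" using 5 by (simp add: w_def)
  then have "w \<ge> 1" using order_trans[OF _ w, of 1] by simp
  then have "2 ^ w \<le> ack (Suc i) w" using "5.IH"(3) by (simp add: w_def)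
  moreover have "(2::nat) ^ 1 \<le> 2 ^ w" using \<open>w \<ge> 1\<close> by (intro power_increasing) auto
  ultimately have "2 \<le> ack (Suc i) w" by simp
  then have "2 ^ Suc j * 2 \<le> w * ack (Suc i) w" using w by (intro mult_mono) auto
  then show ?case by (simp add: w_def)
qed auto

lemma mono_ack: "i \<ge> 1 \<Longrightarrow> mono (ack i)"
proof -
  assume i: "i \<ge> 1"
  have "ack i j \<le> ack i (Suc j)" for j
  proof (cases "i = 1 \<or> j = 0")
    case True
    then show ?thesis using i by (cases i; cases "i - 1") auto
  next
    case False
    then obtain i' where i': "i = Suc i'" "i' \<ge> 1" using i by (cases i) auto
    have "ack i j \<ge> 2 ^ j" using False i power_le_ack by simp
    then have "ack i j \<ge> 1" using order_trans[of 1 "2 ^ j" "ack i j"] by simp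
    then have "ack i' (ack i j) \<ge> 2 ^ ack i j" using i' power_le_ack by simp
    then have "ack i' (ack i j) \<ge> 1" using order_trans[of 1 "2 ^ ack i j" "ack i' (ack i j)"] by simp
    then show ?thesis using ack_rec[of i' j] i' False by simp
  qed
  then show ?thesis by (simp add: mono_iff_le_Suc)
qed

lemma ack_mono: "i \<ge> 1 \<Longrightarrow> j \<le> j' \<Longrightarrow> ack i j \<le> ack i j'"
  using mono_ack by (rule monoD)

text \<open>Three steps of the recursion: the first absorbs the constants into \<open>W1\<close>,
  the second the factor \<open>t\<close> into \<open>W2\<close>, the third the outer value of
  \<open>ack i\<close>. \<open>j \<ge> 8\<close> makes \<open>W\<close> at least
  \<open>2 ^ 8\<close>, enough for all constants.\<close>

lemma ack_growth:
  assumes "i \<ge> 1" "j \<ge> 8"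
  defines "W \<equiv> ack (Suc i) j"
  defines "t \<equiv> ack i (6 * W + 8)"
  shows "W * (2 * t * ack i (3 * (W * t + W) + 8)) \<le> ack (Suc i) (j + 3)"
proof -
  define W1 W2 where "W1 = ack (Suc i) (j + 1)" and "W2 = ack (Suc i) (j + 2)"
  have "(2::nat) ^ 8 \<le> 2 ^ j" using assms by (intro power_increasing) auto
  also have "\<dots> \<le> W" unfolding W_def using assms by (intro power_le_ack) auto
  finally have W: "W \<ge> 256" by simp
  have "(2::nat) ^ 8 \<le> 2 ^ W" using W by (intro power_increasing) auto
  also have "\<dots> \<le> ack i W" using assms W by (intro power_le_ack) auto
  finally have "256 \<le> ack i W" by simp
  then have W1: "256 * W \<le> W1" using ack_rec[of i j] assms by (simp add: W1_def W_def mult.commute)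
  have t: "t \<ge> 1"
    using power_le_ack[of i "6 * W + 8"] assms order_trans[of 1 "2 ^ (6 * W + 8)" t] by (simp add: t_def)
  have "6 * W + 8 \<le> W1" using W1 W by simp
  then have "t \<le> ack i W1" unfolding t_def using assms by (intro ack_mono)
  then have "256 * W * t \<le> W1 * ack i W1" using W1 by (intro mult_mono) auto
  then have W2: "256 * W * t \<le> W2" using ack_rec[of i "j + 1"] assms by (simp add: W1_def W2_def)
  have "W \<le> W * t" using t by simp
  then have "3 * (W * t + W) + 8 \<le> 3 * (W * t + W * t) + W * t"
    using order_trans[of 8 W "W * t"] W by (intro add_mono mult_le_mono) auto
  also have "\<dots> \<le> 256 * (W * t)" by simp
  finally have "3 * (W * t + W) + 8 \<le> 256 * (W * t)" .
  then have "3 * (W * t + W) + 8 \<le> W2" using W2 by (simp add: mult.assoc)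
  then have "ack i (3 * (W * t + W) + 8) \<le> ack i W2" using assms by (intro ack_mono)
  then have "(256 * W * t) * ack i (3 * (W * t + W) + 8) \<le> W2 * ack i W2" using W2 by (intro mult_mono) auto
  also have "\<dots> = ack (Suc i) (j + 3)" using ack_rec[of i "j + 2"] assms by (simp add: W2_def eval_nat_numeral)
  finally have "256 * (W * t * ack i (3 * (W * t + W) + 8)) \<le> ack (Suc i) (j + 3)" by (simp add: mult.assoc)
  then show ?thesis by (simp add: mult.assoc mult.left_commute)
qed

text \<open>One unit of \<open>h\<close> pays for the three recursion steps of
  \<open>ack_growth\<close>, and the offset 8 meets its condition on \<open>j\<close>. Level 0 sits
  in row 2, where a recursion step multiplies \<open>w\<close> by \<open>2 ^ w\<close>.\<close>

definition bound :: "nat \<Rightarrow> nat \<Rightarrow> nat" where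
  "bound k h = ack (k + 2) (3 * h + 8)"

lemma bound_ge_1: "bound k h \<ge> 1"
  using order_trans[OF _ power_le_ack[of "k + 2" "3 * h + 8"], of 1] by (simp add: bound_def)

lemma bound_mono: "h \<le> h' \<Longrightarrow> bound k h \<le> bound k h'"
  unfolding bound_def by (intro ack_mono) auto

lemma double_le_power: "2 * n \<le> (2::nat) ^ n"
proof (cases n)
  case (Suc n')
  then show ?thesis using Suc_leI[OF less_exp[of n']] by simp
qed simp

lemma bound_0_growth: "bound 0 h * (2 * bound 0 h) \<le> bound 0 (Suc h)"
proof -
  define w where "w = bound 0 h"
  have "2 * w \<le> 2 ^ w" by (rule double_le_power)
  then have "w * (2 * w) \<le> ack 2 (Suc (3 * h + 8))"
    using ack_rec[of 1 "3 * h + 8"] by (simp add: w_def bound_def numeral_2_eq_2)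
  also have "\<dots> \<le> bound 0 (Suc h)" unfolding bound_def by (simp add: ack_mono numeral_2_eq_2)
  finally show ?thesis by (simp add: w_def)
qed

text \<open>Bounds the number of blocks of the composed sequence when the guests have at most \<open>w\<close> blocks.\<close>

definition level_factor :: "nat \<Rightarrow> nat \<Rightarrow> nat" where
  "level_factor k w = 2 * bound k (2 * w) * bound k (w * bound k (2 * w) + w)"

lemma bound_Suc_growth: "bound (Suc k) h * level_factor k (bound (Suc k) h) \<le> bound (Suc k) (Suc h)"
  using ack_growth[of "k + 2" "3 * h + 8"] by (simp add: level_factor_def bound_def add.commute add.left_commute)

lemma mono_level_factor: "mono (level_factor k)"
  unfolding level_factor_def
  by (intro monoI mult_mono bound_mono add_mono) auto

section \<open>Induction on the level for orders 4 and 5\<close>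

fun mult5 :: "nat \<Rightarrow> nat" where
  "mult5 0 = 1"
| "mult5 (Suc k) = 2 ^ k + 2 * mult5 k"

lemma mult5_eq: "2 * mult5 k = (k + 2) * 2 ^ k"
  by (induction k) (auto simp: algebra_simps)

lemma mult5_ge_1: "mult5 k \<ge> 1"
  by (induction k) auto

definition realizable :: "nat \<Rightarrow> nat \<Rightarrow> nat \<Rightarrow> bool" where
  "realizable K v k \<longleftrightarrow> (\<forall>f g. f \<ge> 1 \<longrightarrow> g \<ge> 1 \<longrightarrow>
     (\<exists>Z :: nat blocks. valid K v f g Z \<and> word Z \<noteq> [] \<and> length Z \<le> bound k (f + g)))"

text \<open>At level 0 the hosts are grids, with \<open>p + q \<le> 2 * max p q\<close>
  blocks.\<close>

lemma realizable_0:
  assumes "K \<ge> 5"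
  shows "realizable K 1 0"
  unfolding realizable_def
proof (intro allI impI)
  fix f g :: nat assume "f \<ge> 1" "g \<ge> 1"
  have "\<exists>S :: nat blocks. sized p q S \<and> regular 1 S \<and> runs_le K S \<and> word S \<noteq> [] \<and> length S \<le> 2 * max p q"
    if "p \<ge> 1" "q \<ge> 1" for p q
  proof -
    have "p + q \<le> 2 * max p q" by simp
    then show ?thesis using admissible_grid[OF that assms] unfolding admissible_def by metis
  qed
  from fill_family[where C = "bound 0" and R = "\<lambda>w. 2 * w", OF assms _ bound_ge_1 _ bound_0_growth this, of f g] \<open>f \<ge> 1\<close> \<open>g \<ge> 1\<close>
  show "\<exists>Z :: nat blocks. valid K 1 f g Z \<and> word Z \<noteq> [] \<and> length Z \<le> bound 0 (f + g)"
    by (auto simp: mono_def)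
qed

lemma realizable_Suc:
  assumes "K \<ge> 5" "v \<ge> 1" and "\<And>p q. p \<ge> 1 \<Longrightarrow> q \<ge> 1 \<Longrightarrow>
      \<exists>S. admissible K v p q S \<and> length S \<le> level_factor k (max p q)"
  shows "realizable K v (Suc k)"
  unfolding realizable_def
proof (intro allI impI)
  fix f g :: nat assume "f \<ge> 1" "g \<ge> 1"
  have "\<exists>S :: nat blocks. sized p q S \<and> regular v S \<and> runs_le K S \<and> word S \<noteq> [] \<and> length S \<le> level_factor k (max p q)"
    if "p \<ge> 1" "q \<ge> 1" for p q
    using assms(3)[OF that] unfolding admissible_def by metis
  from fill_family[where C = "bound (Suc k)", OF assms(1,2) bound_ge_1 mono_level_factor bound_Suc_growth this, of f g]
    \<open>f \<ge> 1\<close> \<open>g \<ge> 1\<close>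
  show "\<exists>Z :: nat blocks. valid K v f g Z \<and> word Z \<noteq> [] \<and> length Z \<le> bound (Suc k) (f + g)"
    by auto
qed

lemma realizable_order4: "realizable 5 (2 ^ k) k"
proof (induction k)
  case (Suc k)
  show ?case
  proof (rule realizable_Suc)
    fix p q :: nat assume pq: "p \<ge> 1" "q \<ge> 1"
    then obtain Y :: "nat blocks" where Y: "valid 5 (2 ^ k) p q Y" "word Y \<noteq> []" "length Y \<le> bound k (p + q)"
      using Suc unfolding realizable_def by blast
    obtain S where S: "admissible 5 (2 * 2 ^ k) p q S" "length S \<le> 2 * length Y"
      using admissible_double Y by blast
    have "length Y \<le> bound k (2 * max p q)" by (rule order_trans[OF Y(3) bound_mono]) (simp add: max_def)
    \<comment> \<open>Order 4 is charged the larger cost of order 5, so that both orders share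
      \<open>bound\<close>; the last factor is replaced by 1.\<close>
    then have "2 * length Y * 1 \<le> level_factor k (max p q)"
      unfolding level_factor_def by (intro mult_mono bound_ge_1) auto
    then show "\<exists>S. admissible 5 (2 ^ Suc k) p q S \<and> length S \<le> level_factor k (max p q)" using S by auto
  qed auto
qed (use realizable_0[of 5] in simp)

lemma realizable_order5: "realizable 6 (mult5 k) k"
proof (induction k)
  case (Suc k)
  show ?case
  proof (rule realizable_Suc)
    fix p q :: nat assume pq: "p \<ge> 1" "q \<ge> 1"
    define m where "m = max p q"
    obtain M :: "nat blocks" where M: "valid 5 (2 ^ k) p q M" "word M \<noteq> []" "length M \<le> bound k (p + q)"
      using realizable_order4 pq unfolding realizable_def by blast
    have "cnt True M \<ge> 1" using M by (intro regular_cnt_pos[of "2 ^ k"]) (auto simp: valid_def)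
    then have "p * cnt True M \<ge> 1" using pq by simp
    \<comment> \<open>\<open>Y\<close> is chosen after \<open>M\<close>, with blocks of first
      occurrences large enough for the symbols of one copy of \<open>M\<close>. This nests one use
      of \<open>bound k\<close> inside another.\<close>
    then obtain Y :: "nat blocks" where Y: "valid 6 (mult5 k) (p * cnt True M) q Y" "word Y \<noteq> []"
      "length Y \<le> bound k (p * cnt True M + q)"
      using Suc pq unfolding realizable_def by blast
    obtain S where S: "admissible 6 (2 ^ k + 2 * mult5 k) p q S" "length S \<le> max 2 (length M) * length Y"
      using admissible_nest[OF M(1) Y(1,2)] by blast
    have lM: "length M \<le> bound k (2 * m)" by (rule order_trans[OF M(3) bound_mono]) (simp add: m_def max_def)
    then have "cnt True M \<le> bound k (2 * m)" using cnt_le_length order_trans by blast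
    then have "p * cnt True M + q \<le> m * bound k (2 * m) + m"
      by (intro add_mono mult_mono) (auto simp: m_def)
    then have "length Y \<le> bound k (m * bound k (2 * m) + m)" using Y(3) bound_mono order_trans by blast
    moreover have "max 2 (length M) \<le> 2 * bound k (2 * m)" using lM bound_ge_1[of k "2 * m"] by simp
    ultimately have "max 2 (length M) * length Y \<le> level_factor k m"
      unfolding level_factor_def by (intro mult_mono) auto
    then show "\<exists>S. admissible 6 (mult5 (Suc k)) p q S \<and> length S \<le> level_factor k (max p q)"
      using S by (auto simp: m_def)
  next
    show "1 \<le> mult5 (Suc k)" by (rule mult5_ge_1)
  qed auto
qed (use realizable_0[of 6] in simp)

section \<open>Davenport-Schinzel bounds\<close>

lemma count_list_filter: "count_list (filter P xs) x = (if P x then count_list xs x else 0)"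
  by (induction xs) auto

lemma count_list_distinct: "distinct xs \<Longrightarrow> count_list xs x = (if x \<in> set xs then 1 else 0)"
  by (induction xs) auto

lemma count_word: "(\<forall>B\<in>set Z. distinct (snd B)) \<Longrightarrow> count_list (word Z) x = length (occ x Z)"
  by (induction Z) (auto simp: count_list_distinct)

lemma length_eq_card_mult:
  assumes "\<And>x. x \<in> X \<Longrightarrow> count_list xs x = v" "set xs \<subseteq> X" "finite X"
  shows "length xs = card X * v"
  using sum_count_set[OF assms(2,3)] assms(1) by simp

lemma occ_filter_not_fst: "occ x (filter (\<lambda>B. \<not> fst B) Z) = filter Not (occ x Z)"
  by (induction Z) auto

lemma length_nonfirsts: "sized f g Z \<Longrightarrow> length (word (filter (\<lambda>B. \<not> fst B) Z)) = g * cnt False Z"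
  by (induction Z) (auto simp: sized_def)

lemma length_eq_cnt: "length Z = cnt True Z + cnt False Z"
  by (induction Z) auto

text \<open>Double counting: with sizes in the ratio \<open>1 : v\<close> there are equally many
  blocks of first and of later occurrences, each kind being half of \<open>length Z\<close>.\<close>

lemma card_word:
  assumes "sized (2 * j) (2 * v * j) Z" "regular v Z" "v \<ge> 1"
  shows "card (set (word Z)) = j * length Z"
proof -
  let ?N = "card (set (word Z))"
  have 1: "?N = 2 * j * cnt True Z"
    using distinct_card[OF distinct_firsts[OF assms(1,2)]] length_firsts[OF assms(1)]
      set_word_filter_fst[OF assms(2)] by simp
  have "length (word (filter (\<lambda>B. \<not> fst B) Z)) = ?N * v"
  proof (rule length_eq_card_mult)
    show "set (word (filter (\<lambda>B. \<not> fst B) Z)) \<subseteq> set (word Z)" by (auto simp: word_def)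
    fix x assume "x \<in> set (word Z)"
    then have "occ x Z = True # replicate v False" using assms by (simp add: regular_def)
    then show "count_list (word (filter (\<lambda>B. \<not> fst B) Z)) x = v"
      using assms(1) by (subst count_word) (auto simp: occ_filter_not_fst sized_def)
  qed simp
  then have "v * ?N = 2 * v * j * cnt False Z"
    using length_nonfirsts[OF assms(1)] by (metis mult.commute)
  also have "\<dots> = v * (2 * j * cnt False Z)" by simp
  finally have "v * ?N = v * (2 * j * cnt False Z)" .
  then have "?N = 2 * j * cnt False Z" using assms(3) mult_cancel1[of v ?N] by (metis not_one_le_zero)
  then have "2 * ?N = 2 * (j * length Z)" using 1 by (simp add: length_eq_cnt algebra_simps)
  then show ?thesis by simp
qed

text \<open>The alternation survives the projection to its two symbols and has seven runs, while a
  pattern of length 6 admits six.\<close>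

lemma no_alt7:
  assumes "runs_le 6 Z"
  shows "\<not> has_alt7 (word Z)"
proof
  assume "has_alt7 (word Z)"
  then obtain a b where ab: "a \<noteq> b" "subseq [a, b, a, b, a, b, a] (word Z)" unfolding has_alt7_def by blast
  let ?u = "[a, b, a, b, a, b, a]"
  have "subseq (filter (\<lambda>z. z = a \<or> z = b) ?u) (proj a b Z)"
    unfolding proj_def using ab(2) by (rule subseq_filter)
  then have u: "subseq ?u (proj a b Z)" by simp
  have "distinct_adj ?u" using ab(1) by (simp add: distinct_adj_Cons)
  moreover obtain c d where "fits (alternate 6 c d) (proj a b Z)"
    using assms ab(1) unfolding runs_le_def by blast
  then have "fits (alternate 6 c d) ?u" using fits_subseq[OF u] by blast
  ultimately have "length ?u \<le> length (alternate 6 c d)" using fits_length by blast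
  then show False by simp
qed

section \<open>Finiteness of both suprema, and lower bounds by witnesses\<close>

lemma has_alt7_mono: "subseq xs ys \<Longrightarrow> has_alt7 xs \<Longrightarrow> has_alt7 ys"
  unfolding has_alt7_def using subseq_order.order_trans by blast

lemma is_m_block_filter_word:
  assumes "\<forall>B\<in>set Z. distinct (snd B)" "length Z \<le> m"
  shows "is_m_block m (filter P (word Z))"
  unfolding is_m_block_def
proof (intro exI conjI)
  show "length (map (filter P \<circ> snd) Z) \<le> m" using assms by simp
  show "filter P (word Z) = concat (map (filter P \<circ> snd) Z)" by (induction Z) auto
  show "\<forall>b\<in>set (map (filter P \<circ> snd) Z). distinct b" using assms by auto
qed

text \<open>Only for a bounded set does \<open>Sup\<close> on the naturals dominate the members.
  Each of the \<open>m\<close> blocks has at most \<open>n\<close> entries.\<close>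

lemma bdd_above_blocks:
  "bdd_above {length xs |xs. card (set xs) \<le> n \<and> is_m_block m xs \<and> \<not> has_alt7 xs}"
proof (rule bdd_aboveI)
  fix l assume "l \<in> {length xs |xs. card (set xs) \<le> n \<and> is_m_block m xs \<and> \<not> has_alt7 xs}"
  then obtain xs where xs: "l = length xs" "card (set xs) \<le> n" "is_m_block m xs" by blast
  from xs(3) obtain bs where "length bs \<le> m" "xs = concat bs" "\<forall>b\<in>set bs. distinct b"
    unfolding is_m_block_def by blast
  then have bs: "length bs \<le> m" "l = length (concat bs)" "\<forall>b\<in>set bs. distinct b"
    "card (set (concat bs)) \<le> n"
    using xs by simp_all
  have "length b \<le> n" if "b \<in> set bs" for b
  proof -
    have "length b = card (set b)" using bs(3) that distinct_card by fastforce
    also have "\<dots> \<le> card (set (concat bs))" using that by (intro card_mono) auto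
    finally show ?thesis using bs(4) by simp
  qed
  then have "length (concat bs) \<le> length bs * n"
    by (induction bs) (auto intro: add_mono)
  also have "\<dots> \<le> m * n" using bs(1) by simp
  finally show "l \<le> m * n" using bs(2) by simp
qed

lemma lambda5_blocks_ge:
  "card (set xs) \<le> n \<Longrightarrow> is_m_block m xs \<Longrightarrow> \<not> has_alt7 xs \<Longrightarrow> length xs \<le> lambda5_blocks n m"
  unfolding lambda5_blocks_def using bdd_above_blocks by (intro cSup_upper) blast+

fun pair_count :: "'a \<Rightarrow> 'a \<Rightarrow> 'a list \<Rightarrow> nat" where
  "pair_count a b (x # y # zs) = (if x = a \<and> y = b then Suc (pair_count a b zs) else pair_count a b (y # zs))"
| "pair_count a b _ = 0"

text \<open>Adjacent pairs \<open>a b\<close> cannot overlap since \<open>a \<noteq> b\<close>, so that four of them contain \<open>a b a b a b a\<close>.\<close>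

lemma subseq_pair_count: "subseq (concat (replicate (pair_count a b xs) [a, b])) xs"
proof (induction a b xs rule: pair_count.induct)
  case (1 a b x y zs)
  then show ?case by (auto intro: subseq_Cons')
qed auto

lemma count_zip_tl: "a \<noteq> b \<Longrightarrow> count_list (zip xs (tl xs)) (a, b) = pair_count a b xs"
proof (induction a b xs rule: pair_count.induct)
  case (1 a b x y zs)
  show ?case
  proof (cases "x = a \<and> y = b")
    case True
    then show ?thesis using 1 by (cases zs) auto
  qed (use 1 in auto)
qed auto

lemma pair_count_le:
  assumes "a \<noteq> b" "\<not> has_alt7 xs"
  shows "pair_count a b xs \<le> 3"
proof (rule ccontr)
  assume "\<not> pair_count a b xs \<le> 3"
  then have "pair_count a b xs = 4 + (pair_count a b xs - 4)" by simp
  then obtain k where k: "pair_count a b xs = 4 + k" by blast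
  have "subseq ([a, b, a, b, a, b, a] @ b # concat (replicate k [a, b])) xs"
    using subseq_pair_count[of a b xs] by (simp add: k eval_nat_numeral)
  moreover have "subseq [a, b, a, b, a, b, a] ([a, b, a, b, a, b, a] @ b # concat (replicate k [a, b]))"
    by (intro prefix_imp_subseq prefixI) (rule refl)
  ultimately have "subseq [a, b, a, b, a, b, a] xs" by (rule subseq_order.order_trans[rotated])
  then show False using assms unfolding has_alt7_def by blast
qed

text \<open>Each of at most \<open>n * n\<close> ordered pairs occurs at most three times among the
  neighbours, and there is one entry more than there are neighbouring pairs.\<close>

lemma bdd_above_lambda5:
  "bdd_above {length xs |xs. card (set xs) \<le> n \<and> no_adj_rep xs \<and> \<not> has_alt7 xs}"
proof (rule bdd_aboveI)
  fix l assume "l \<in> {length xs |xs. card (set xs) \<le> n \<and> no_adj_rep xs \<and> \<not> has_alt7 xs}"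
  then obtain xs where xs: "l = length xs" "card (set xs) \<le> n" "no_adj_rep xs" "\<not> has_alt7 xs" by blast
  let ?z = "zip xs (tl xs)" and ?X = "set xs \<times> set xs"
  have "set (tl xs) \<subseteq> set xs" by (cases xs) auto
  then have "set ?z \<subseteq> ?X" by (auto dest: set_zip_leftD set_zip_rightD)
  then have "length ?z = (\<Sum>p\<in>?X. count_list ?z p)" using sum_count_set[of ?z ?X] by simp
  also have "\<dots> \<le> (\<Sum>p\<in>?X. 3)"
  proof (rule sum_mono)
    fix p assume "p \<in> ?X"
    obtain a b where p: "p = (a, b)" by (cases p)
    have "p \<notin> set ?z" if "a = b"
    proof
      assume "p \<in> set ?z"
      then obtain i where "i < length ?z" "?z ! i = (a, b)" unfolding p by (metis in_set_conv_nth)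
      then have "Suc i < length xs" "xs ! i = xs ! Suc i" using that by (auto simp: nth_tl)
      then show False using xs(3) by (simp add: no_adj_rep_def)
    qed
    then show "count_list ?z p \<le> 3"
      using pair_count_le[OF _ xs(4)] count_zip_tl[of a b xs] count_notin[of p ?z] unfolding p
      by (cases "a = b") auto
  qed
  also have "\<dots> = 3 * (card (set xs) * card (set xs))" by (simp add: card_cartesian_product)
  also have "\<dots> \<le> 3 * (n * n)" using xs(2) by (intro mult_le_mono) auto
  finally show "l \<le> Suc (3 * (n * n))" using xs(1) by simp
qed

lemma lambda5_ge:
  "card (set xs) \<le> n \<Longrightarrow> no_adj_rep xs \<Longrightarrow> \<not> has_alt7 xs \<Longrightarrow> length xs \<le> lambda5 n"
  unfolding lambda5_def using bdd_above_lambda5 by (intro cSup_upper) blast+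

lemma no_adj_rep_iff: "no_adj_rep xs \<longleftrightarrow> distinct_adj xs"
  by (auto simp: no_adj_rep_def distinct_adj_conv_nth)

lemma distinct_no_alt7: "distinct xs \<Longrightarrow> \<not> has_alt7 xs"
proof
  assume "distinct xs" "has_alt7 xs"
  then obtain a b where "subseq [a, b, a, b, a, b, a] xs" unfolding has_alt7_def by blast
  then have "subseq (filter ((=) a) [a, b, a, b, a, b, a]) (filter ((=) a) xs)" by (rule subseq_filter)
  then have "length (filter ((=) a) [a, b, a, b, a, b, a]) \<le> length (filter ((=) a) xs)"
    by (rule list_emb_length)
  then have "4 \<le> count_list xs a" by (cases "a = b") (simp_all add: count_list_eq_length_filter)
  then show False using \<open>distinct xs\<close> by (simp add: count_list_distinct split: if_splits)
qed

lemma lambda5_blocks_ge_n: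
  assumes "m \<ge> 1"
  shows "n \<le> lambda5_blocks n m"
proof -
  have "is_m_block m [0..<n]"
    unfolding is_m_block_def by (rule exI[of _ "[[0..<n]]"]) (use assms in auto)
  then show ?thesis using lambda5_blocks_ge[of "[0..<n]" n m] by (simp add: distinct_no_alt7)
qed

lemma distinct_adj_distinct: "distinct xs \<Longrightarrow> distinct_adj xs"
  by (simp add: distinct_adj_altdef remdups_adj_distinct)

lemma lambda5_ge_n: "n \<le> lambda5 n"
  using lambda5_ge[of "[0..<n]" n] by (simp add: no_adj_rep_iff distinct_no_alt7 distinct_adj_distinct)

text \<open>Only the seam can collapse, and it loses a single letter.\<close>

lemma length_remdups_adj_append:
  "length (remdups_adj xs) + length (remdups_adj ys) \<le> Suc (length (remdups_adj (xs @ ys)))"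
proof (induction xs rule: remdups_adj.induct)
  case (2 x)
  then show ?case by (cases ys) (auto simp: remdups_adj_Cons split: list.splits)
qed auto

lemma length_concat_le_remdups_adj:
  "\<forall>b\<in>set bs. distinct b \<Longrightarrow> length (concat bs) \<le> length (remdups_adj (concat bs)) + length bs"
proof (induction bs)
  case (Cons b bs)
  then show ?case using length_remdups_adj_append[of b "concat bs"] by (simp add: remdups_adj_distinct)
qed simp

lemma subseq_remdups_adj: "subseq (remdups_adj xs) xs"
proof (induction xs rule: remdups_adj.induct)
  case (3 x y xs)
  then show ?case by (auto intro: subseq_Cons' list_emb_Cons)
qed auto

text \<open>Deleting adjacent repetitions costs at most one letter per block, so at most
  \<open>n\<close>, and \<open>n \<le> lambda5 n\<close>.\<close>

lemma lambda5_blocks_le_lambda5: "lambda5_blocks n n \<le> 2 * lambda5 n"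
proof -
  have "lambda5_blocks n n \<le> lambda5 n + n"
    unfolding lambda5_blocks_def
  proof (rule cSup_least)
    have "is_m_block n []" unfolding is_m_block_def by (rule exI[of _ "[]"]) simp
    then show "{length xs |xs. card (set xs) \<le> n \<and> is_m_block n xs \<and> \<not> has_alt7 xs} \<noteq> {}"
      using distinct_no_alt7[of "[]"] by fastforce
    fix l assume "l \<in> {length xs |xs. card (set xs) \<le> n \<and> is_m_block n xs \<and> \<not> has_alt7 xs}"
    then obtain xs where xs: "l = length xs" "card (set xs) \<le> n" "is_m_block n xs" "\<not> has_alt7 xs" by blast
    from xs(3) obtain bs where "length bs \<le> n" "xs = concat bs" "\<forall>b\<in>set bs. distinct b"
      unfolding is_m_block_def by blast
    then have bs: "length bs \<le> n" "l = length (concat bs)" "\<forall>b\<in>set bs. distinct b"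
      "card (set (concat bs)) \<le> n" "\<not> has_alt7 (concat bs)"
      using xs by simp_all
    have "length (remdups_adj (concat bs)) \<le> lambda5 n"
      using bs(4,5) has_alt7_mono[OF subseq_remdups_adj]
      by (intro lambda5_ge) (auto simp: no_adj_rep_iff)
    then show "l \<le> lambda5 n + n" using length_concat_le_remdups_adj[OF bs(3)] bs by simp
  qed
  then show ?thesis using lambda5_ge_n[of n] by simp
qed

section \<open>Disjoint copies, obtained by filling empty host blocks\<close>

lemma word_fill_copies:
  "word (fill D t (replicate r (c, []))) = concat (map (\<lambda>s. map (guest s) (word (D c))) [t..<t + r])"
  by (induction r arbitrary: t) (auto simp: upt_conv_Cons)

lemma length_fill_copies: "length (fill D t (replicate r (c, []))) = r * length (D c)"
  by (induction r arbitrary: t) auto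

lemma card_fill_copies: "card (set (word (fill D t (replicate r (c, []))))) = r * card (set (word (D c)))"
proof -
  have "set (word (fill D t (replicate r (c, [])))) = (\<lambda>(s, b). guest s b) ` ({t..<t + r} \<times> set (word (D c)))"
    by (auto simp: word_fill_copies)
  then show ?thesis by (simp add: card_image inj_on_def card_cartesian_product)
qed

lemma sized_fill_copies:
  fixes D :: "bool \<Rightarrow> nat blocks"
  shows "sized f g (D c) \<Longrightarrow> sized f g (fill D t (replicate r (c, [])))"
proof (induction r arbitrary: t)
  case 0
  then show ?case by (simp add: sized_def)
next
  case (Suc r)
  then show ?case using sized_ren[of "guest t" "D c" f g] by (simp add: inj_on_def)
qed

text \<open>As many disjoint copies of \<open>Z\<close> as \<open>m\<close> allows use at least half
  of the \<open>m\<close> blocks. With \<open>j\<close> symbols per block this gives at least half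
  of \<open>n\<close> symbols, each with \<open>v + 1\<close> occurrences.\<close>

lemma lambda5_blocks_lower:
  fixes Z :: "nat blocks"
  assumes Z: "valid 6 v (2 * j) (2 * v * j) Z" "v \<ge> 1" "length Z \<le> m" "Z \<noteq> []" and n: "n \<le> j * m"
  shows "n * v \<le> 2 * lambda5_blocks n m"
proof -
  define r where "r = m div length Z"
  define D where "D = (\<lambda>c :: bool. Z)"
  define S :: "nat blocks" where "S = replicate r (False, [])"
  define W where "W = fill D 0 S"
  have szd: "sized (2 * j) (2 * v * j) Z" and rg: "regular v Z" using Z by (auto simp: valid_def)
  interpret filling D 6
    by standard (use Z(1) in \<open>auto simp: D_def valid_def sized_def\<close>)
  have S: "fits_into S" "word S = []" by (auto simp: S_def fits_into_def word_def)
  then have rS: "runs_le 6 S" "regular v S" using runs_le_empty_word[of 6 S] by (auto simp: regular_def)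
  have W_reg: "regular v W" unfolding W_def using S rS rg by (intro regular_fill) (auto simp: D_def)
  have "runs_le 6 W" unfolding runs_le_def W_def
  proof (intro allI impI)
    fix x y :: nat assume "x \<noteq> y"
    then consider "ok 6 x y (fill D 0 S)" | "ok 6 y x (fill D 0 S)" using ok_fill S rS by blast
    then show "fits (alternate 6 x y) (proj x y (fill D 0 S)) \<or> fits (alternate 6 y x) (proj x y (fill D 0 S))"
      by cases (use ok_runs[of 6 x y] ok_runs[of 6 y x] \<open>x \<noteq> y\<close> proj_sym[of x y] in auto)
  qed
  then have alt: "\<not> has_alt7 (word W)" by (rule no_alt7)
  have "sized (2 * j) (2 * v * j) W"
    unfolding W_def S_def by (rule sized_fill_copies) (simp add: D_def szd)
  then have dist: "\<forall>B\<in>set W. distinct (snd B)" by (simp add: sized_def)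
  have l: "length W = r * length Z" by (simp add: W_def S_def length_fill_copies D_def)
  then have "length W \<le> m" by (simp add: r_def)
  \<comment> \<open>The rest of the division is shorter than one copy, and at least one copy is
    present, so the rest is at most \<open>length W\<close>.\<close>
  have "m mod length Z < length Z" using Z(4) by simp
  moreover have "m div length Z \<ge> 1" using Z(3,4) by (simp add: Suc_le_eq div_greater_zero_iff)
  then have "length Z \<le> m div length Z * length Z" by simp
  ultimately have "m \<le> 2 * length W"
    using div_mult_mod_eq[of m "length Z"] unfolding l r_def by linarith
  then have "j * m \<le> j * (2 * length W)" by (rule mult_le_mono2)
  moreover have cW: "card (set (word W)) = j * length W"
    using card_word[OF szd rg Z(2)] by (simp add: W_def S_def card_fill_copies D_def length_fill_copies)
  then have "j * (2 * length W) = 2 * card (set (word W))" by simp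
  ultimately have "n \<le> 2 * card (set (word W))" using n by simp
  then have n2: "n \<le> 2 * min n (card (set (word W)))" by (simp add: min_def)
  \<comment> \<open>Keeping only the symbols of \<open>A\<close> meets the bound \<open>n\<close> on their number without adding blocks.\<close>
  obtain A where A: "A \<subseteq> set (word W)" "card A = min n (card (set (word W)))" "finite A"
    using obtain_subset_with_card_n[of "min n (card (set (word W)))" "set (word W)"]
    by (metis List.finite_set min.cobounded2 finite_subset)
  define xs where "xs = filter (\<lambda>z. z \<in> A) (word W)"
  have "card (set xs) \<le> n"
    using A card_mono[of A "set xs"] by (auto simp: xs_def)
  moreover have "is_m_block m xs" unfolding xs_def using dist \<open>length W \<le> m\<close> by (rule is_m_block_filter_word)
  moreover have "\<not> has_alt7 xs" using alt has_alt7_mono[of xs "word W"] by (auto simp: xs_def)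
  ultimately have "length xs \<le> lambda5_blocks n m" by (rule lambda5_blocks_ge)
  moreover have "length xs = card A * Suc v"
  proof (rule length_eq_card_mult)
    fix x assume "x \<in> A"
    then have "occ x W = True # replicate v False" using A W_reg by (auto simp: regular_def)
    then show "count_list xs x = Suc v" using \<open>x \<in> A\<close> dist by (simp add: xs_def count_list_filter count_word)
  qed (use A in \<open>auto simp: xs_def\<close>)
  ultimately have "card A * v \<le> lambda5_blocks n m" by simp
  moreover have "n * v \<le> 2 * card A * v" using n2 A(2) by (intro mult_le_mono1) simp
  then have "n * v \<le> 2 * (card A * v)" by (simp only: mult.assoc)
  ultimately show ?thesis by linarith
qed

section \<open>Comparison with the inverse Ackermann function\<close>

lemma ack_large:
  assumes "i \<ge> 1" "j \<ge> 2"
  shows "2 ^ (i + j - 1) \<le> ack i j"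
  using assms(2)
proof (induction j rule: dec_induct)
  case base
  \<comment> \<open>The bound \<open>2 ^ j\<close> of \<open>power_le_ack\<close> ignores the row;
    the exact value at \<open>j = 2\<close> brings \<open>i\<close> into the exponent.\<close>
  have "ack i 2 = 2 ^ Suc i" using assms(1)
  proof (induction i rule: dec_induct)
    case (step i)
    then show ?case using ack_rec[of i 1] by (cases i) (simp_all add: numeral_2_eq_2)
  qed simp
  then show ?case by simp
next
  case (step j)
  show ?case
  proof (cases "i = 1")
    case False
    then obtain i' where i': "i = Suc i'" "i' \<ge> 1" using assms(1) by (cases i) auto
    have "1 \<le> ack i j" using step order_trans[of 1 "2 ^ (i + j - 1)" "ack i j"] by simp
    then have "2 ^ 1 \<le> (2 :: nat) ^ ack i j" by (intro power_increasing) auto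
    also have "\<dots> \<le> ack i' (ack i j)" using i' \<open>1 \<le> ack i j\<close> by (intro power_le_ack) auto
    finally have "2 ^ (i + j - 1) * 2 \<le> ack i j * ack i' (ack i j)" using step by (intro mult_mono) auto
    also have "\<dots> = ack i (Suc j)" using ack_rec[of i' j] i' step by simp
    finally show ?thesis using step by (simp add: i' flip: power_Suc2)
  qed simp
qed

lemma ack_le_ack_of_rec:
  assumes "i \<ge> 1" "j \<ge> 1"
  shows "ack i (ack (Suc i) j) \<le> ack (Suc i) (Suc j)"
proof -
  have "1 \<le> ack (Suc i) j" using power_le_ack[of "Suc i" j] assms order_trans[of 1 "2 ^ j" "ack (Suc i) j"] by simp
  then show ?thesis using ack_rec[OF assms] by simp
qed

text \<open>Two more rows absorb the argument. It is at most \<open>2 ^ (J - 1)\<close>, hence at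
  most \<open>ack (k + 3) (J - 1)\<close>; one recursion step leads to \<open>ack (k + 3) J\<close>,
  and a second, by the choice of \<open>J\<close>, to \<open>ack (k + 4) j\<close>.\<close>

lemma bound_le_ack:
  assumes k: "k \<ge> 1" and j: "j \<ge> 3"
  shows "bound k (2 * j + 2 * mult5 k * j) \<le> ack (k + 4) j"
proof -
  define J where "J = ack (k + 4) (j - 1)"
  have "2 ^ (k + j + 2) \<le> J"
    using ack_large[of "k + 4" "j - 1"] j by (simp add: J_def)
  moreover have "2 * (k + j + 2) \<le> 2 ^ (k + j + 2)" by (rule double_le_power)
  ultimately have "2 * (k + j + 2) \<le> J" by (rule order_trans[rotated])
  then have J: "j + 2 * k + 4 \<le> J - 1" "J \<ge> 2" using j by simp_all
  have "k + 2 \<le> 2 ^ Suc k" using less_exp[of "Suc k"] by simp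
  then have "2 * mult5 k \<le> 2 ^ Suc k * 2 ^ k" unfolding mult5_eq by (rule mult_le_mono1)
  then have "2 * mult5 k \<le> 2 * 2 ^ (2 * k)" by (simp only: power_Suc mult.assoc flip: power_add mult_2)
  then have "mult5 k \<le> 2 ^ (2 * k)" by simp
  then have "1 + mult5 k \<le> 2 ^ (2 * k) + 2 ^ (2 * k)" by (intro add_mono) simp_all
  then have v: "1 + mult5 k \<le> 2 ^ (2 * k + 1)" by simp
  \<comment> \<open>Any lower bound of 4 lets the additive 8 be absorbed when the factor rises from
    6 to 8.\<close>
  have "3 * 2 \<le> j * (1 + mult5 k)" using j mult5_ge_1[of k] by (intro mult_le_mono) auto
  then have "3 * (2 * j + 2 * mult5 k * j) + 8 \<le> 8 * (j * (1 + mult5 k))" by (simp add: algebra_simps)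
  also have "\<dots> \<le> 8 * (2 ^ j * 2 ^ (2 * k + 1))"
    using v less_exp[of j] by (intro mult_le_mono) auto
  also have "\<dots> = 2 ^ (j + 2 * k + 4)" by (simp add: power_add)
  also have "\<dots> \<le> 2 ^ (J - 1)" using J by (intro power_increasing) auto
  also have "\<dots> \<le> ack (k + 3) (J - 1)" using J by (intro power_le_ack) auto
  finally have "bound k (2 * j + 2 * mult5 k * j) \<le> ack (k + 2) (ack (k + 3) (J - 1))"
    unfolding bound_def by (intro ack_mono) auto
  also have "\<dots> \<le> ack (k + 3) J"
    using ack_le_ack_of_rec[of "k + 2" "J - 1"] J by (simp add: eval_nat_numeral)
  also have "\<dots> \<le> ack (k + 4) j"
    using ack_le_ack_of_rec[of "k + 3" "j - 1"] j unfolding J_def by (simp add: eval_nat_numeral)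
  finally show ?thesis .
qed

lemma lambda5_blocks_alpha2:
  assumes "n \<ge> 1" "m \<ge> 1"
  shows "n * alpha2 n m * 2 ^ alpha2 n m \<le> 256 * lambda5_blocks n m"
proof -
  define i where "i = alpha2 n m"
  define j where "j = max (nat \<lceil>real n / real m\<rceil>) 3"
  show ?thesis
  proof (cases "i \<ge> 6")
    case False
    \<comment> \<open>For small \<open>i\<close> the trivial bound
      \<open>n \<le> lambda5_blocks n m\<close> is enough, as
      \<open>5 * 2 ^ 5 = 160\<close>.\<close>
    then have "i * 2 ^ i \<le> 5 * 2 ^ 5" by (intro mult_le_mono power_increasing) auto
    then have "n * (i * 2 ^ i) \<le> n * 256" by (intro mult_le_mono2) simp
    also have "\<dots> \<le> 256 * lambda5_blocks n m" using lambda5_blocks_ge_n[OF assms(2), of n] by simp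
    finally show ?thesis by (simp add: i_def mult.assoc)
  next
    case True
    \<comment> \<open>With this \<open>k\<close> the row \<open>k + 4\<close> of
      \<open>bound_le_ack\<close> is \<open>i - 1\<close>, the last one that minimality of
      \<open>alpha2 n m\<close> keeps below \<open>m\<close>.\<close>
    define k where "k = i - 5"
    have k: "k \<ge> 1" "i = k + 5" using True by (auto simp: k_def)
    have "i - 1 < alpha2 n m" using True by (simp add: i_def)
    then have "\<not> (i - 1 \<ge> 1 \<and> ack (i - 1) j \<ge> m)"
      unfolding alpha2_def j_def by (rule not_less_Least)
    then have am: "ack (k + 4) j \<le> m" using k by (simp add: add.commute)
    have j: "j \<ge> 3" by (simp add: j_def)
    have "real n / real m \<le> real j" unfolding j_def by linarith
    then have "real n \<le> real j * real m" using assms by (simp add: field_simps)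
    then have nj: "n \<le> j * m" by (metis of_nat_le_iff of_nat_mult)
    have "2 * mult5 k * j \<ge> 1" "2 * j \<ge> 1" using j mult5_ge_1[of k] by simp_all
    then obtain Z :: "nat blocks" where Z: "valid 6 (mult5 k) (2 * j) (2 * mult5 k * j) Z" "word Z \<noteq> []"
      "length Z \<le> bound k (2 * j + 2 * mult5 k * j)"
      using realizable_order5[of k] unfolding realizable_def by blast
    have "length Z \<le> m" using Z(3) bound_le_ack[OF k(1) j] am by linarith
    then have "n * mult5 k \<le> 2 * lambda5_blocks n m"
      using Z nj mult5_ge_1 by (intro lambda5_blocks_lower) auto
    then have "n * (2 * mult5 k) \<le> 4 * lambda5_blocks n m" by simp
    then have *: "64 * (n * ((k + 2) * 2 ^ k)) \<le> 256 * lambda5_blocks n m" unfolding mult5_eq by simp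
    \<comment> \<open>The loss from \<open>i\<close> to \<open>k\<close> is a constant: 2 in the
      linear factor and \<open>2 ^ 5\<close> in the power, together 64.\<close>
    have "i \<le> 2 * (k + 2)" using k by simp
    then have "i * 2 ^ i \<le> 2 * (k + 2) * 2 ^ i" by (rule mult_le_mono1)
    also have "\<dots> = 64 * ((k + 2) * 2 ^ k)" by (simp add: k power_add)
    finally have "i * 2 ^ i \<le> 64 * ((k + 2) * 2 ^ k)" .
    then have "n * (i * 2 ^ i) \<le> n * (64 * ((k + 2) * 2 ^ k))" by (rule mult_le_mono2)
    also have "\<dots> = 64 * (n * ((k + 2) * 2 ^ k))" by simp
    also note *
    finally show ?thesis by (simp add: i_def mult.assoc)
  qed
qed

theorem mainTheorem12:
  shows "(\<exists>c>0. \<exists>N. \<forall>n m. n \<ge> N \<and> m \<ge> N \<longrightarrow>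
            real (lambda5_blocks n m) \<ge> c * real n * real (alpha2 n m) * 2 ^ alpha2 n m)
       \<and> (\<exists>c>0. \<exists>N. \<forall>n. n \<ge> N \<longrightarrow>
            real (lambda5 n) \<ge> c * real n * real (alpha1 n) * 2 ^ alpha1 n)"
proof -
  have "1 / 256 * real n * real (alpha2 n m) * 2 ^ alpha2 n m \<le> real (lambda5_blocks n m)"
    if "n \<ge> 1" "m \<ge> 1" for n m
  proof -
    have "real (n * alpha2 n m * 2 ^ alpha2 n m) \<le> real (256 * lambda5_blocks n m)"
      using lambda5_blocks_alpha2[OF that] by (simp only: of_nat_le_iff)
    then show ?thesis by simp
  qed
  moreover have "1 / 512 * real n * real (alpha1 n) * 2 ^ alpha1 n \<le> real (lambda5 n)" if "n \<ge> 1" for n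
  proof -
    \<comment> \<open>The constant doubles because \<open>lambda5_blocks n n\<close> is at most
      twice \<open>lambda5 n\<close>.\<close>
    have "n * alpha1 n * 2 ^ alpha1 n \<le> 512 * lambda5 n"
      using lambda5_blocks_alpha2[OF that that] lambda5_blocks_le_lambda5[of n] unfolding alpha1_def by linarith
    then have "real (n * alpha1 n * 2 ^ alpha1 n) \<le> real (512 * lambda5 n)" by (simp only: of_nat_le_iff)
    then show ?thesis by simp
  qed
  ultimately show ?thesis
    by (intro conjI exI[of _ "1 / 256 :: real"] exI[of _ "1 / 512 :: real"] exI[of _ "1 :: nat"]) auto
qed

end
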